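(* Let $\lambda,k>0$, let $G$ be a Gamma random variable with parameters $\lambda,k$ (density $\frac{\lambda^k}{\Gamma(k)}e^{-\lambda z}z^{k-1}$, $z>0$), and let $B$ be a Brownian motion starting from zero with $\operatorname{Var}B(t)=2t$, independent of $G$. Then the crossing probability of $G$ by $B$ is $$\psi^k_{\frac12}(t)=\Pr\{|B(t)|<G\}=1-(\lambda\sqrt t)^kE^k_{\frac12,\frac k2+1}(-\lambda\sqrt t),\qquad t>0.$$ For every integer $k\ge1$ it satisfies the fractional relaxation equation $$\sum_{j=1}^k\binom kj\lambda^{-j}\frac{d^{\frac j2}}{dt^{\frac j2}}\psi^k_{\frac12}(t)=-\psi^k_{\frac12}(t),\qquad t>0,$$ with initial condition $\psi^k_{\frac12}(0)=1$ for $k\ge1$, and the additional conditions $$\left.\frac{d^r}{dt^r}\psi^k_{\frac12}(t)\right|_{t=0}=0,\quad r=1,\dots,\left\lfloor\tfrac k2\right\rfloor,\ \text{for any odd }k>1,$$ $$\left.\frac{d^r}{dt^r}\psi^k_{\frac12}(t)\right|_{t=0}=0,\quad r=1,\dots,\tfrac k2-1,\ \text{for any even }k>2.$$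
   Context: $\psi^k_{\frac12}(t)=\int_0^\infty[1-F_G(y)]\frac{e^{-y^2/4t}}{\sqrt{\pi t}}\,dy$, where $F_G$ is the distribution function of $G$. The generalized Mittag-Leffler function is $$E^\gamma_{\alpha,\beta}(z)=\sum_{j=0}^\infty\frac{(\gamma)_j\,z^j}{j!\,\Gamma(\alpha j+\beta)},\qquad (\gamma)_0=1,\ (\gamma)_j=\gamma(\gamma+1)\cdots(\gamma+j-1).$$ $\frac{d^\nu}{dt^\nu}$ is the Caputo derivative: for $m-1<\nu<m$, $m\in\mathbb{N}$, $\frac{d^\nu}{dt^\nu}u(t)=\frac{1}{\Gamma(m-\nu)}\int_0^t\frac{1}{(t-s)^{1+\nu-m}}\frac{d^m}{ds^m}u(s)\,ds$, and $\frac{d^\nu}{dt^\nu}u=\frac{d^m}{dt^m}u$ for $\nu=m$. Values at $t=0$ are understood as limits $t\to0^+$. *)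

theory Defs
  imports "HOL-Probability.Probability"
begin

definition gamma_density :: "real \<Rightarrow> real \<Rightarrow> real \<Rightarrow> real" where
  "gamma_density rate k z =
     (if 0 < z then rate powr k / Gamma k * exp (- rate * z) * z powr (k - 1) else 0)"

text \<open>
  Brownian motion on the time axis \<open>[0, \<infinity>)\<close>, starting from zero, with variance parameter \<open>v\<close>,
  that is, with variance \<open>v * t\<close> at time \<open>t\<close>. The third argument of
  \<^const>\<open>normal_density\<close> is the evaluation point and the second the standard deviation.
\<close>

definition brownian_motion :: "'a measure \<Rightarrow> real \<Rightarrow> (real \<Rightarrow> 'a \<Rightarrow> real) \<Rightarrow> bool" where
  "brownian_motion M v B \<longleftrightarrow>
     prob_space M \<and>
     (\<forall>t\<ge>0. B t \<in> borel_measurable M) \<and>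
     (AE \<omega> in M. B 0 \<omega> = 0) \<and>
     (\<forall>n (\<tau> :: nat \<Rightarrow> real). 0 \<le> \<tau> 0 \<and> (\<forall>i<n. \<tau> i < \<tau> (Suc i)) \<longrightarrow>
        prob_space.indep_vars M (\<lambda>_. borel) (\<lambda>i \<omega>. B (\<tau> (Suc i)) \<omega> - B (\<tau> i) \<omega>) {..<n}) \<and>
     (\<forall>s t. 0 \<le> s \<and> s < t \<longrightarrow>
        distributed M lborel (\<lambda>\<omega>. B t \<omega> - B s \<omega>)
          (\<lambda>x. ennreal (normal_density 0 (sqrt (v * (t - s))) x))) \<and>
     (AE \<omega> in M. continuous_on {0..} (\<lambda>t. B t \<omega>))"

text \<open>
  The random variable \<open>G\<close> is independent of the whole process \<open>(B t)\<close>, \<open>t \<ge> 0\<close>: the generated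
  sigma-algebras are independent. (\<open>indep_var\<close> does not apply because it requires both variables
  to take values in the same type.)
\<close>

definition indep_of_process ::
  "'a measure \<Rightarrow> ('a \<Rightarrow> real) \<Rightarrow> (real \<Rightarrow> 'a \<Rightarrow> real) \<Rightarrow> bool" where
  "indep_of_process M G B \<longleftrightarrow>
     prob_space.indep_set M
       (sigma_sets (space M) {G -` A \<inter> space M | A. A \<in> sets borel})
       (sigma_sets (space M) {B t -` A \<inter> space M | t A. 0 \<le> t \<and> A \<in> sets borel})"

definition crossing_psi :: "'a measure \<Rightarrow> ('a \<Rightarrow> real) \<Rightarrow> real \<Rightarrow> real" where
  "crossing_psi M G t =
     (LINT y:{0<..}|lborel.
        (1 - cdf (distr M borel G) y) * (exp (- (y\<^sup>2 / (4 * t))) / sqrt (pi * t)))"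

definition gen_mittag_leffler :: "real \<Rightarrow> real \<Rightarrow> real \<Rightarrow> real \<Rightarrow> real" where
  "gen_mittag_leffler \<gamma> \<alpha> \<beta> z =
     (\<Sum>j. pochhammer \<gamma> j * z ^ j / (fact j * Gamma (\<alpha> * real j + \<beta>)))"

text \<open>
  Caputo derivative of order \<open>\<nu> > 0\<close>. With \<open>m = \<lceil>\<nu>\<rceil>\<close> one has \<open>\<nu> = m\<close> or \<open>m - 1 < \<nu> < m\<close>.
\<close>

definition caputo_integrand :: "real \<Rightarrow> (real \<Rightarrow> real) \<Rightarrow> real \<Rightarrow> real \<Rightarrow> real" where
  "caputo_integrand \<nu> u t s =
     (let m = nat \<lceil>\<nu>\<rceil> in 1 / (t - s) powr (1 + \<nu> - real m) * (deriv ^^ m) u s)"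

definition caputo_deriv :: "real \<Rightarrow> (real \<Rightarrow> real) \<Rightarrow> real \<Rightarrow> real" where
  "caputo_deriv \<nu> u t =
     (let m = nat \<lceil>\<nu>\<rceil> in
        if \<nu> = real m then (deriv ^^ m) u t
        else 1 / Gamma (real m - \<nu>) * (LINT s:{0<..<t}|lborel. caputo_integrand \<nu> u t s))"

text \<open>
  Since \<^const>\<open>deriv\<close> and the Lebesgue integral are total, the existence of the Caputo
  derivative is a separate condition: the classical derivatives up to order \<open>m\<close> exist and
  the integral converges absolutely.
\<close>

definition caputo_differentiable :: "real \<Rightarrow> (real \<Rightarrow> real) \<Rightarrow> real \<Rightarrow> bool" where
  "caputo_differentiable \<nu> u t \<longleftrightarrow>
     (let m = nat \<lceil>\<nu>\<rceil> in
        (\<forall>i<m. \<forall>s\<in>{0<..t}. (deriv ^^ i) u differentiable (at s)) \<and>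
        (\<nu> \<noteq> real m \<longrightarrow> set_integrable lborel {0<..<t} (caputo_integrand \<nu> u t)))"

end

theory Submission
  imports Defs
begin

text \<open>
  Integrating the power series of the Gamma distribution function against the Gaussian kernel
  term by term, the duplication formula turns the \<open>j\<close>-th moment into
  \<open>t^((k+j)/2) \<Gamma>(k+j+1) / \<Gamma>((k+j)/2 + 1)\<close>, which gives the Mittag-Leffler form. For integral
  \<open>k = n\<close> this makes \<open>\<psi> - 1\<close> a series in \<open>t^(i/2) / \<Gamma>(i/2 + 1)\<close> with \<open>i \<ge> n\<close>. The first \<open>n\<close> powers
  being absent, every Caputo derivative of order \<open>j/2\<close> with \<open>j \<le> n\<close> merely shifts the index \<open>i\<close>
  by \<open>j\<close>. Comparing coefficients, the relaxation equation becomes the vanishing of the \<open>n\<close>-th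
  finite difference of the polynomial \<open>x \<mapsto> x choose (n - 1)\<close>.
\<close>

subsection \<open>Power series in half-integral powers\<close>

text \<open>With D the Caputo derivative of order 1/2, the relaxation operator together with its
  \<open>j = 0\<close> term is formally (1 + D/\<lambda>)^n. Encode t^(i/2)/\<Gamma>(i/2 + 1) as
  x^i: then \<psi> - 1 becomes -(\<lambda>x/(1 + \<lambda>x))^n, D becomes division by x, and (1 +
  1/(\<lambda>x))^n maps the former to -1, the constant that turns a statement about \<psi> - 1 into
  one about \<psi>. The finite difference is this identity read off coefficientwise. The obstacle is
  the behaviour at 0. For odd j the Caputo derivative of order j/2 integrates the classical
  derivative of order m = (j + 1)/2, whose leading power t^(n/2 - m) is at worst t^(-1/2) as long as
  j \<le> n; this keeps the singular integral convergent. All convergence questions about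
  half-integral powers come down to one estimate: coefficients of at most geometric growth are
  beaten by 1/\<Gamma>(i/2 + \<beta>), so that each such series is a power of t times an entire
  function of sqrt t.\<close>

lemma summable_abs_rGamma_power_nat:
  fixes \<beta> y :: real
  assumes "y \<ge> 0"
  shows "summable (\<lambda>m. \<bar>rGamma (real m + \<beta>)\<bar> * y ^ m)"
proof -
  obtain N where N: "real N \<ge> 2 * y + \<bar>\<beta>\<bar> + 1"
    using real_arch_simple by blast
  show ?thesis
  proof (rule summable_ratio_test[of "1/2" N])
    fix m assume "m \<ge> N"
    then have m: "real m + \<beta> \<ge> 2 * y" "real m + \<beta> \<ge> 1"
      using N assms by (smt (verit) of_nat_le_iff)+
    have "\<bar>rGamma (real m + \<beta>)\<bar> = (real m + \<beta>) * \<bar>rGamma (real (Suc m) + \<beta>)\<bar>"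
      using rGamma_plus1[of "real m + \<beta>"] m
      by (metis (no_types, opaque_lifting) abs_mult abs_of_nonneg add.commute add.left_commute
          dual_order.trans of_nat_Suc zero_le_one)
    moreover have "y * \<bar>rGamma (real (Suc m) + \<beta>)\<bar> \<le> (real m + \<beta>) / 2 * \<bar>rGamma (real (Suc m) + \<beta>)\<bar>"
      using m by (intro mult_right_mono) auto
    ultimately have "y * \<bar>rGamma (real (Suc m) + \<beta>)\<bar> \<le> 1/2 * \<bar>rGamma (real m + \<beta>)\<bar>"
      by simp
    then have "y ^ m * (y * \<bar>rGamma (real (Suc m) + \<beta>)\<bar>) \<le> y ^ m * (1/2 * \<bar>rGamma (real m + \<beta>)\<bar>)"
      using assms by (intro mult_left_mono) auto
    then show "norm (\<bar>rGamma (real (Suc m) + \<beta>)\<bar> * y ^ Suc m)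
        \<le> 1/2 * norm (\<bar>rGamma (real m + \<beta>)\<bar> * y ^ m)"
      using assms by (simp add: abs_mult mult_ac)
  qed simp
qed

text \<open>The recurrence of 1/\<Gamma> moves the argument by 1, the index only by 1/2. Hence the
  split into even and odd indices, each a series in \<open>x\<^sup>2\<close> with integral steps,
  with offsets \<beta> and \<beta> + 1/2.\<close>

lemma summable_abs_rGamma_power_half:
  fixes \<beta> x :: real
  assumes "x \<ge> 0"
  shows "summable (\<lambda>j. \<bar>rGamma (real j / 2 + \<beta>)\<bar> * x ^ j)"
proof -
  let ?e = "\<lambda>m. \<bar>rGamma (real m + \<beta>)\<bar> * (x\<^sup>2) ^ m"
  let ?o = "\<lambda>m. \<bar>rGamma (real m + (1/2 + \<beta>))\<bar> * (x\<^sup>2) ^ m * x"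
  have "summable ?e" by (rule summable_abs_rGamma_power_nat) simp
  moreover have "summable ?o"
    by (intro summable_mult2 summable_abs_rGamma_power_nat) simp
  ultimately have "(\<lambda>n. if even n then ?e (n div 2) else ?o ((n - 1) div 2)) sums (suminf ?o + suminf ?e)"
    by (intro sums_if summable_sums)
  moreover have "(if even j then ?e (j div 2) else ?o ((j - 1) div 2)) =
      \<bar>rGamma (real j / 2 + \<beta>)\<bar> * x ^ j" for j
  proof (cases "even j")
    case True
    then obtain m where "j = 2 * m" by blast
    then show ?thesis by (simp add: power_mult)
  next
    case False
    then obtain m where m: "j = 2 * m + 1" using oddE by blast
    have "real j / 2 + \<beta> = real m + (1/2 + \<beta>)" by (simp add: m field_simps)
    moreover have "x ^ j = (x\<^sup>2) ^ m * x" by (simp add: m power_mult power_add)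
    moreover have "(j - 1) div 2 = m" by (simp add: m)
    ultimately show ?thesis using False by (simp only: if_False mult.assoc)
  qed
  ultimately show ?thesis by (simp add: sums_iff)
qed

lemma powr_half_diff:
  fixes q t :: real
  assumes "t > 0"
  shows "t powr (real i / 2 - q) = t powr (- q) * sqrt t ^ i"
proof -
  have "t powr (real i / 2) = sqrt t ^ i"
    using assms by (simp add: powr_powr flip: powr_half_sqrt powr_realpow)
  then show ?thesis
    using powr_add[of t "- q" "real i / 2"] by simp
qed

text \<open>
  Using \<^const>\<open>rGamma\<close>, which vanishes at the poles of \<^const>\<open>Gamma\<close>, instead of a quotient makes
  \<open>d/dt\<close> act as the shift \<open>q \<mapsto> q + 1\<close> without exceptional terms, and Abel's half-order integral
  as \<open>q \<mapsto> q - 1/2\<close>.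
\<close>

definition half_series :: "(nat \<Rightarrow> real) \<Rightarrow> real \<Rightarrow> real \<Rightarrow> real" where
  "half_series c q t = (\<Sum>i. c i * rGamma (real i / 2 + 1 - q) * t powr (real i / 2 - q))"

context
  fixes c :: "nat \<Rightarrow> real" and C :: real
  assumes C: "C \<ge> 0" and c_bound: "\<And>i. \<bar>c i\<bar> \<le> C ^ i"
begin

text \<open>The growth of \<open>c\<close> is absorbed into the argument, which becomes
  \<open>C * \<bar>x\<bar>\<close>. The offset \<beta> stays free because every derivative changes
  it.\<close>

lemma summable_half_coeffs:
  "summable (\<lambda>i. \<bar>c i\<bar> * \<bar>rGamma (real i / 2 + \<beta>)\<bar> * \<bar>x\<bar> ^ i)"
proof (rule summable_comparison_test')
  show "summable (\<lambda>i. \<bar>rGamma (real i / 2 + \<beta>)\<bar> * (C * \<bar>x\<bar>) ^ i)"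
    by (rule summable_abs_rGamma_power_half) (use C in simp)
  fix i
  have "\<bar>c i\<bar> * (\<bar>rGamma (real i / 2 + \<beta>)\<bar> * \<bar>x\<bar> ^ i) \<le> C ^ i * (\<bar>rGamma (real i / 2 + \<beta>)\<bar> * \<bar>x\<bar> ^ i)"
    using c_bound by (intro mult_right_mono) auto
  then show "norm (\<bar>c i\<bar> * \<bar>rGamma (real i / 2 + \<beta>)\<bar> * \<bar>x\<bar> ^ i) \<le> \<bar>rGamma (real i / 2 + \<beta>)\<bar> * (C * \<bar>x\<bar>) ^ i"
    by (simp add: abs_mult power_mult_distrib mult_ac power_abs)
qed

lemma summable_half_power_series: "summable (\<lambda>i. c i * rGamma (real i / 2 + \<beta>) * x ^ i)"
  by (rule summable_norm_cancel) (use summable_half_coeffs[of \<beta> x] in \<open>simp add: abs_mult power_abs\<close>)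

lemma half_series_eq_power_series:
  assumes "t > 0"
  shows "half_series c q t = t powr (- q) * (\<Sum>i. c i * rGamma (real i / 2 + (1 - q)) * sqrt t ^ i)"
    and "summable (\<lambda>i. c i * rGamma (real i / 2 + 1 - q) * t powr (real i / 2 - q))"
proof -
  have *: "c i * rGamma (real i / 2 + 1 - q) * t powr (real i / 2 - q) =
      t powr (- q) * (c i * rGamma (real i / 2 + (1 - q)) * sqrt t ^ i)" for i
    using assms by (simp add: powr_half_diff add_diff_eq)
  show "summable (\<lambda>i. c i * rGamma (real i / 2 + 1 - q) * t powr (real i / 2 - q))"
    unfolding * by (intro summable_mult summable_half_power_series)
  show "half_series c q t = t powr (- q) * (\<Sum>i. c i * rGamma (real i / 2 + (1 - q)) * sqrt t ^ i)"
    unfolding half_series_def * by (intro suminf_mult summable_half_power_series)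
qed

text \<open>The series is differentiated as t^(-q) P(sqrt t) with P entire, so uniform convergence
  in t never has to be discussed.\<close>

lemma has_derivative_half_series:
  assumes t: "t > 0"
  shows "(half_series c q has_real_derivative half_series c (q + 1) t) (at t)"
proof -
  define a where "a i = c i * rGamma (real i / 2 + (1 - q))" for i
  have a: "summable (\<lambda>i. a i * x ^ i)" for x
    unfolding a_def by (rule summable_half_power_series)
  define P where "P x = (\<Sum>i. a i * x ^ i)" for x
  define P' where "P' x = (\<Sum>i. diffs a i * x ^ i)" for x
  have P: "(P has_real_derivative P' x) (at x)" for x
    unfolding P_def P'_def by (rule termdiffs_strong_converges_everywhere) (rule a)
  \<comment> \<open>The chain rule produces P' multiplied by sqrt t after t^(-q-1) is pulled out.
    The product x P'(x) has coefficients \<open>i * a i\<close> without an index shift, so it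
    combines termwise with -q P.\<close>
  have P'sum: "(\<lambda>i. real i * a i * x ^ i) sums (x * P' x)" for x
  proof -
    have "summable (\<lambda>i. diffs a i * x ^ i)"
      by (rule termdiff_converges_all) (rule a)
    from sums_mult[OF diffs_equiv[OF this], of x] show ?thesis
      unfolding P'_def
      by (rule back_subst[of "\<lambda>f. f sums _"])
        (auto simp: fun_eq_iff power_eq_if mult_ac)
  qed
  have "((\<lambda>s. s powr (- q) * P (sqrt s)) has_real_derivative
      (- q) * t powr (- q - 1) * P (sqrt t) + t powr (- q) * (P' (sqrt t) * (inverse (sqrt t) / 2))) (at t)"
    using t by (auto intro!: derivative_eq_intros DERIV_chain2[OF P])
  also have "(- q) * t powr (- q - 1) * P (sqrt t) + t powr (- q) * (P' (sqrt t) * (inverse (sqrt t) / 2))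
      = t powr (- q - 1) * ((- q) * P (sqrt t) + (sqrt t * P' (sqrt t)) / 2)"
  proof -
    have "t powr (- q) = t powr (- q - 1) * t" using t by (simp add: powr_diff)
    moreover have "t * inverse (sqrt t) = sqrt t" using t
      by (simp add: divide_inverse [symmetric] real_div_sqrt)
    ultimately show ?thesis by (simp add: algebra_simps)
  qed
  also have "(- q) * P (sqrt t) + (sqrt t * P' (sqrt t)) / 2 =
      (\<Sum>i. c i * rGamma (real i / 2 + (1 - (q + 1))) * sqrt t ^ i)"
  proof (rule sums_unique)
    have "(\<lambda>i. (- q) * (a i * sqrt t ^ i) + (real i * a i * sqrt t ^ i) / 2) sums
        ((- q) * P (sqrt t) + (sqrt t * P' (sqrt t)) / 2)"
      unfolding P_def by (intro sums_add sums_mult sums_divide P'sum summable_sums a)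
    moreover have "(- q) * (a i * sqrt t ^ i) + (real i * a i * sqrt t ^ i) / 2 =
        c i * rGamma (real i / 2 + (1 - (q + 1))) * sqrt t ^ i" for i
    proof -
      \<comment> \<open>The functional equation of 1/\<Gamma> holds at every argument; when i/2 - q
        is 0 both sides vanish, which is the disappearance of a differentiated constant.\<close>
      have "(real i / 2 - q) * rGamma (real i / 2 + (1 - q)) = rGamma (real i / 2 + (1 - (q + 1)))"
        using rGamma_plus1[of "real i / 2 - q"] by (simp add: add_diff_eq diff_add_eq)
      then have "c i * rGamma (real i / 2 + (1 - (q + 1))) = (real i / 2 - q) * a i"
        by (simp only: a_def mult_ac)
      then show ?thesis by (simp only: left_diff_distrib mult.assoc)
    qed
    ultimately show "(\<lambda>i. c i * rGamma (real i / 2 + (1 - (q + 1))) * sqrt t ^ i) sums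
        ((- q) * P (sqrt t) + (sqrt t * P' (sqrt t)) / 2)"
      by simp
  qed
  also have "t powr (- q - 1) * \<dots> = half_series c (q + 1) t"
    using half_series_eq_power_series(1)[OF t, of "q + 1"] by (simp only: minus_add_distrib diff_conv_add_uminus)
  finally have D: "((\<lambda>s. s powr (- q) * P (sqrt s)) has_real_derivative half_series c (q + 1) t) (at t)" .
  have ev: "\<forall>\<^sub>F s in nhds t. s powr (- q) * P (sqrt s) = half_series c q s"
    using eventually_nhds_in_open[of "{0<..}" t] t
    by (auto elim!: eventually_mono simp: half_series_eq_power_series(1) P_def a_def)
  show ?thesis
    using D DERIV_cong_ev[OF refl ev refl] by blast
qed

text \<open>With the first \<open>n\<close> coefficients gone, the series is t^(n/2 - q) Q(sqrt t)
  with Q entire, and the positive exponent forces the limit.\<close>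

lemma tendsto_half_series_0:
  assumes vanish: "\<And>i. i < n \<Longrightarrow> c i = 0" and q: "q < real n / 2"
  shows "(half_series c q \<longlongrightarrow> 0) (at_right 0)"
proof -
  define a where "a i = c i * rGamma (real i / 2 + (1 - q))" for i
  have a: "summable (\<lambda>i. a i * x ^ i)" for x
    unfolding a_def by (rule summable_half_power_series)
  define Q where "Q x = (\<Sum>i. a (i + n) * x ^ i)" for x
  have aQ: "summable (\<lambda>i. a (i + n) * x ^ i)" for x
  proof (cases "x = 0")
    case False
    have "summable (\<lambda>i. a (i + n) * x ^ (i + n) / x ^ n)"
      using a by (intro summable_divide summable_ignore_initial_segment)
    then show ?thesis using False by (simp add: power_add)
  qed simp
  have "isCont Q 0"
    unfolding Q_def[abs_def]
    using DERIV_isCont termdiffs_strong_converges_everywhere[OF aQ] by blast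
  then have "(Q \<longlongrightarrow> Q 0) (at 0)" by (simp add: isCont_def)
  moreover have "filterlim sqrt (at 0) (at_right (0::real))"
  proof -
    have "(sqrt \<longlongrightarrow> 0) (at_right 0)"
      by (rule tendsto_eq_rhs[OF tendsto_real_sqrt[OF tendsto_ident_at]]) simp
    then show ?thesis
      by (auto simp: filterlim_at eventually_at_filter)
  qed
  ultimately have Q: "((\<lambda>t. Q (sqrt t)) \<longlongrightarrow> Q 0) (at_right 0)"
    by (rule filterlim_compose)
  have "((\<lambda>t. t powr (real n / 2 - q)) \<longlongrightarrow> 0) (at_right 0)"
    by (rule tendsto_eq_rhs[OF tendsto_powr'[OF tendsto_ident_at tendsto_const]])
      (use q in \<open>auto simp: eventually_at_filter\<close>)
  from tendsto_mult[OF this Q]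
  have "((\<lambda>t. t powr (real n / 2 - q) * Q (sqrt t)) \<longlongrightarrow> 0) (at_right 0)" by simp
  moreover have "t powr (real n / 2 - q) * Q (sqrt t) = half_series c q t" if "t > 0" for t
  proof -
    have "(\<Sum>i. a i * sqrt t ^ i) = (\<Sum>i. a (i + n) * sqrt t ^ (i + n))"
      by (subst suminf_split_initial_segment[OF a, of _ n]) (simp add: a_def vanish)
    also have "\<dots> = sqrt t ^ n * Q (sqrt t)"
      unfolding Q_def by (subst suminf_mult[symmetric, OF aQ]) (simp add: power_add mult_ac)
    finally show ?thesis
      using half_series_eq_power_series(1)[OF that, of q] that
      by (simp add: a_def powr_half_diff)
  qed
  ultimately show ?thesis
    by (rule Lim_transform_eventually[OF _ eventually_at_right_less[THEN eventually_mono]])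
qed

end

subsection \<open>Beta and Gaussian integrals\<close>

text \<open>Exchange of sum and integral by absolute convergence, keeping integrability and value
  together. It serves the Abel integral, the Gamma distribution function and the Gaussian integral
  alike.\<close>

lemma has_bochner_integral_suminf:
  fixes f :: "nat \<Rightarrow> 'a \<Rightarrow> real"
  assumes "\<And>i. has_bochner_integral M (f i) (I i)"
    and "\<And>i. has_bochner_integral M (\<lambda>x. \<bar>f i x\<bar>) (J i)"
    and "summable J" and "\<And>x. summable (\<lambda>i. \<bar>f i x\<bar>)"
  shows "has_bochner_integral M (\<lambda>x. \<Sum>i. f i x) (\<Sum>i. I i)"
proof -
  have "integrable M (f i)" "integral\<^sup>L M (f i) = I i" "(\<integral>x. norm (f i x) \<partial>M) = J i" for i
    using assms(1,2)[of i] by (simp_all add: has_bochner_integral_iff)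
  then show ?thesis
    using integrable_suminf[of M f] integral_suminf[of M f] assms(3,4)
    by (simp add: has_bochner_integral_iff)
qed

text \<open>Carries the gauge integrals of Beta, Gamma and power functions over to Lebesgue
  integrals; nonnegativity is what makes the two notions agree.\<close>

lemma has_bochner_integral_of_has_integral_nonneg:
  fixes f :: "real \<Rightarrow> real"
  assumes "f \<in> borel_measurable borel" "S \<in> sets borel" "\<And>x. x \<in> S \<Longrightarrow> 0 \<le> f x" "(f has_integral I) S"
  shows "has_bochner_integral lborel (\<lambda>x. indicator S x *\<^sub>R f x) I"
proof (rule has_bochner_integral_nn_integral)
  show "(\<integral>\<^sup>+ x. ennreal (indicator S x *\<^sub>R f x) \<partial>lborel) = ennreal I"
    using nn_integral_has_integral_lebesgue[OF assms(3,4)] by simp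
  show "0 \<le> I" using has_integral_nonneg[OF assms(4,3)] .
qed (use assms in \<open>auto simp: indicator_def\<close>)

lemma has_bochner_integral_Beta_half:
  fixes a t :: real
  assumes a: "a > -1" and t: "t > 0"
  shows "has_bochner_integral lborel (\<lambda>s. indicator {0<..<t} s *\<^sub>R (1 / (t - s) powr (1/2) * s powr a))
           (Gamma (1/2) * Gamma (a + 1) * rGamma (a + 3/2) * t powr (a + 1/2))"
proof -
  let ?h = "\<lambda>x. indicator {0..1} x *\<^sub>R (x powr a * (1 - x) powr (- (1/2)) :: real)"
  have "has_bochner_integral lborel ?h (Beta (a + 1) (1/2))"
    using has_integral_Beta_real[of "a + 1" "1/2"] a
    by (intro has_bochner_integral_of_has_integral_nonneg) simp_all
  then have "has_bochner_integral lborel (\<lambda>x. ?h (0 + 1 / t * x)) (Beta (a + 1) (1/2) /\<^sub>R \<bar>1 / t\<bar>)"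
    using t by (subst (asm) lborel_has_bochner_integral_real_affine_iff[of "1/t" _ _ 0]) simp_all
  \<comment> \<open>Scaling the Beta integrand to (0, t) costs t^(-a) from one factor and t^(1/2)
    from the other; this prefactor restores them.\<close>
  then have "has_bochner_integral lborel (\<lambda>x. t powr (a - 1/2) * ?h (0 + 1 / t * x))
      (t powr (a - 1/2) * (Beta (a + 1) (1/2) /\<^sub>R \<bar>1 / t\<bar>))"
    by (rule has_bochner_integral_mult_right)
  moreover have "t powr (a - 1/2) * ?h (0 + 1 / t * x) =
      indicator {0<..<t} x *\<^sub>R (1 / (t - x) powr (1/2) * x powr a)" for x
  proof (cases "0 < x \<and> x < t")
    case True
    have "1 - x / t = (t - x) / t" using t by (simp add: field_simps)
    then have "t powr (a - 1/2) * ((x / t) powr a * (1 - x / t) powr (- (1/2))) =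
        1 / (t - x) powr (1/2) * x powr a"
      using True t powr_diff[of t a "1/2"] by (simp add: powr_divide powr_minus)
    then show ?thesis using True t by (simp add: field_simps indicator_def)
  next
    \<comment> \<open>At the endpoints 0 and t one factor is a power of 0, which \<open>powr\<close>
      evaluates to 0. So the closed and the open interval give the same function.\<close>
    case False
    then show ?thesis using t by (auto simp: indicator_def zero_le_divide_iff)
  qed
  moreover have "t powr (a - 1/2) * (Beta (a + 1) (1/2) /\<^sub>R \<bar>1 / t\<bar>) =
      Gamma (1/2) * Gamma (a + 1) * rGamma (a + 3/2) * t powr (a + 1/2)"
  proof -
    have "t powr (a - 1/2) * t = t powr (a + 1/2)"
      using t powr_add[of t "a - 1/2" 1] by (simp add: add.commute)
    then show ?thesis using t by (simp add: Beta_altdef add.assoc mult_ac)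
  qed
  ultimately show ?thesis by simp
qed

text \<open>In each surviving term the factor 1/\<Gamma>(i/2 + 1 - q) cancels the numerator of the
  Beta value, leaving the same kind of term with q lowered by 1/2. The bound on \<open>q\<close>
  says that all exponents with \<open>i \<ge> n\<close> exceed -1.\<close>

lemma half_series_Abel_integral:
  fixes c :: "nat \<Rightarrow> real"
  assumes C: "C \<ge> 0" "\<And>i. \<bar>c i\<bar> \<le> C ^ i" and t: "t > 0"
    and vanish: "\<And>i. i < n \<Longrightarrow> c i = 0" and q: "q < real n / 2 + 1"
  shows "has_bochner_integral lborel
    (\<lambda>s. indicator {0<..<t} s *\<^sub>R (1 / (t - s) powr (1/2) * half_series c q s))
    (Gamma (1/2) * half_series c (q - 1/2) t)"
proof -
  \<comment> \<open>The coefficient is a parameter \<open>b\<close>, so that one computation covers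
    both \<open>c i\<close> and \<open>\<bar>c i\<bar>\<close>, the latter for the dominating
    series.\<close>
  define f where "f b i s = (indicator {0<..<t} s *\<^sub>R (1 / (t - s) powr (1/2) *
      (b * rGamma (real i / 2 + 1 - q) * s powr (real i / 2 - q))) :: real)" for b i s
  define I where "I b i = Gamma (1/2) * (b * rGamma (real i / 2 + 1 - (q - 1/2)) *
      t powr (real i / 2 - (q - 1/2)))" for b i
  have f: "has_bochner_integral lborel (f b i) (I b i)" if "i < n \<Longrightarrow> b = 0" for b i
  proof (cases "i < n")
    case True
    then show ?thesis using that by (simp add: f_def[abs_def] I_def has_bochner_integral_zero)
  next
    case False
    then have i: "real i / 2 - q > - 1" using q by simp
    have "Gamma (real i / 2 - q + 1) > 0"
      using i by (intro Gamma_real_pos) linarith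
    then have g: "rGamma (real i / 2 + 1 - q) * Gamma (real i / 2 - q + 1) = 1"
      by (simp add: rGamma_inverse_Gamma add_diff_eq diff_add_eq)
    have "has_bochner_integral lborel
        (\<lambda>s. (b * rGamma (real i / 2 + 1 - q)) * (indicator {0<..<t} s *\<^sub>R (1 / (t - s) powr (1/2) * s powr (real i / 2 - q))))
        ((b * rGamma (real i / 2 + 1 - q)) *
          (Gamma (1/2) * Gamma (real i / 2 - q + 1) * rGamma (real i / 2 - q + 3/2) * t powr (real i / 2 - q + 1/2)))"
      by (intro has_bochner_integral_mult_right has_bochner_integral_Beta_half i t)
    moreover have "(b * rGamma (real i / 2 + 1 - q)) *
          (Gamma (1/2) * Gamma (real i / 2 - q + 1) * rGamma (real i / 2 - q + 3/2) * t powr (real i / 2 - q + 1/2))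
        = (rGamma (real i / 2 + 1 - q) * Gamma (real i / 2 - q + 1)) * I b i"
      by (simp add: I_def algebra_simps)
    ultimately show ?thesis unfolding g
      by (simp add: f_def[abs_def] mult_ac)
  qed
  \<comment> \<open>Positivity of 1/\<Gamma> from index \<open>n\<close> on lets the absolute value
    of a term pass to its coefficient alone.\<close>
  have rG: "rGamma (real i / 2 + 1 - q) > 0" "rGamma (real i / 2 + 1 - (q - 1/2)) > 0" if "\<not> i < n" for i
    using that q by (auto simp: rGamma_inverse_Gamma intro!: Gamma_real_pos)
  have abs_f: "\<bar>f (c i) i s\<bar> = f \<bar>c i\<bar> i s" for i s
    using rG(1)[of i] vanish[of i] by (cases "i < n") (auto simp: f_def abs_mult)
  have "has_bochner_integral lborel (\<lambda>s. \<Sum>i. f (c i) i s) (\<Sum>i. I (c i) i)"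
  proof (rule has_bochner_integral_suminf)
    show "has_bochner_integral lborel (f (c i) i) (I (c i) i)" for i
      using vanish by (intro f)
    show "has_bochner_integral lborel (\<lambda>s. \<bar>f (c i) i s\<bar>) (I \<bar>c i\<bar> i)" for i
      unfolding abs_f using vanish by (intro f) simp
    have "summable (\<lambda>i. Gamma (1/2) * (t powr (- (q - 1/2)) *
        (\<bar>c i\<bar> * \<bar>rGamma (real i / 2 + (1 - (q - 1/2)))\<bar> * \<bar>sqrt t\<bar> ^ i)))"
      by (intro summable_mult summable_half_coeffs[OF C])
    moreover have "I \<bar>c i\<bar> i = Gamma (1/2) * (t powr (- (q - 1/2)) *
        (\<bar>c i\<bar> * \<bar>rGamma (real i / 2 + (1 - (q - 1/2)))\<bar> * \<bar>sqrt t\<bar> ^ i))" for i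
    proof (cases "i < n")
      case False
      have "real i / 2 + (1 - (q - 1/2)) = real i / 2 + 1 - (q - 1/2)" by simp
      then show ?thesis using rG(2)[OF False] t
        by (simp only: I_def powr_half_diff[OF t, of i "q - 1/2"]) simp
    qed (simp add: I_def vanish)
    ultimately show "summable (\<lambda>i. I \<bar>c i\<bar> i)" by simp
    show "summable (\<lambda>i. \<bar>f (c i) i s\<bar>)" for s
    proof (cases "0 < s \<and> s < t")
      case True
      have "summable (\<lambda>i. 1 / (t - s) powr (1/2) * (s powr (- q) *
          (\<bar>c i\<bar> * \<bar>rGamma (real i / 2 + (1 - q))\<bar> * \<bar>sqrt s\<bar> ^ i)))"
        by (intro summable_mult summable_half_coeffs[OF C])
      moreover have "\<bar>f (c i) i s\<bar> = 1 / (t - s) powr (1/2) * (s powr (- q) *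
          (\<bar>c i\<bar> * \<bar>rGamma (real i / 2 + (1 - q))\<bar> * \<bar>sqrt s\<bar> ^ i))" for i
        using True by (simp add: f_def abs_mult powr_half_diff add_diff_eq)
      ultimately show ?thesis by simp
    qed (auto simp: f_def)
  qed
  moreover have "(\<Sum>i. f (c i) i s) =
      indicator {0<..<t} s *\<^sub>R (1 / (t - s) powr (1/2) * half_series c q s)" for s
  proof (cases "0 < s \<and> s < t")
    case True
    then have "s > 0" by simp
    from suminf_mult[OF half_series_eq_power_series(2)[OF C this, of q], of "1 / (t - s) powr (1/2)"]
    show ?thesis using True by (simp add: f_def half_series_def)
  qed (auto simp: f_def)
  moreover have "(\<Sum>i. I (c i) i) = Gamma (1/2) * half_series c (q - 1/2) t"
    unfolding I_def half_series_def
    by (intro suminf_mult half_series_eq_power_series(2)[OF C t])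
  ultimately show ?thesis by simp
qed

section \<open>Moments of the Gaussian kernel on the half-line\<close>

lemma Gamma_duplication_real:
  fixes x :: real
  assumes "x > 0"
  shows "Gamma x * Gamma (x + 1/2) = 2 powr (1 - 2 * x) * sqrt pi * Gamma (2 * x)"
proof -
  have "complex_of_real x \<notin> \<int>\<^sub>\<le>\<^sub>0" "complex_of_real x + 1/2 \<notin> \<int>\<^sub>\<le>\<^sub>0"
    using assms by (auto elim!: nonpos_Ints_cases simp: complex_eq_iff)
  from Gamma_legendre_duplication[OF this]
  have "complex_of_real (Gamma x * Gamma (x + 1/2)) =
      complex_of_real (exp ((1 - 2 * x) * ln 2) * sqrt pi * Gamma (2 * x))"
    by (simp flip: Gamma_complex_of_real exp_of_real)
  then show ?thesis
    by (simp only: of_real_eq_iff) (simp add: powr_def)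
qed

lemma has_bochner_integral_gaussian_powr:
  fixes a t :: real
  assumes a: "a > -1" and t: "t > 0"
  shows "has_bochner_integral lborel
    (\<lambda>y. indicator {0<..} y *\<^sub>R (y powr a * (exp (- (y\<^sup>2 / (4 * t))) / sqrt (pi * t))))
    (t powr (a / 2) * Gamma (a + 1) * rGamma (a / 2 + 1))"
proof -
  \<comment> \<open>Under u = y^2/(4t) the measure y^a dy becomes a multiple of u^(x-1) du for this
    \<open>x\<close>; duplication later trades \<Gamma>(x) for
    \<Gamma>(a+1)/\<Gamma>(a/2+1).\<close>
  define x where "x = (a + 1) / 2"
  have x: "x > 0" using a by (simp add: x_def)
  define f where "f u = u powr (x - 1) / exp u" for u :: real
  have f: "(f has_integral Gamma x) {0<..}"
    using Gamma_integral_real[OF x] unfolding f_def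
    by (subst has_integral_spike_set_eq[where T = "{0..}"])
      (auto intro: negligible_subset[of "{0}"])
  then have "f absolutely_integrable_on {0<..}" "integral {0<..} f = Gamma x"
    by (auto intro!: nonnegative_absolutely_integrable_1 simp: has_integral_iff f_def)
  moreover have "(\<lambda>y. y\<^sup>2 / (4 * t)) ` {0<..} = {0<..}"
  proof safe
    fix u :: real assume "u > 0"
    then show "u \<in> (\<lambda>y. y\<^sup>2 / (4 * t)) ` {0<..}"
      using t by (intro image_eqI[of _ _ "sqrt (4 * t * u)"]) auto
  qed (use t in auto)
  moreover have "(\<lambda>y. \<bar>y / (2 * t)\<bar> *\<^sub>R f (y\<^sup>2 / (4 * t))) absolutely_integrable_on {0<..} \<and>
      integral {0<..} (\<lambda>y. \<bar>y / (2 * t)\<bar> *\<^sub>R f (y\<^sup>2 / (4 * t))) = Gamma x \<longleftrightarrow>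
      f absolutely_integrable_on (\<lambda>y. y\<^sup>2 / (4 * t)) ` {0<..} \<and>
      integral ((\<lambda>y. y\<^sup>2 / (4 * t)) ` {0<..}) f = Gamma x"
  proof (rule has_absolute_integral_change_of_variables_real)
    show "((\<lambda>y. y\<^sup>2 / (4 * t)) has_real_derivative y / (2 * t)) (at y within {0<..})" for y
      using t by (auto intro!: derivative_eq_intros)
    show "inj_on (\<lambda>y. y\<^sup>2 / (4 * t)) {0<..}"
      using t by (auto simp: inj_on_def)
  qed auto
  ultimately have "((\<lambda>y. \<bar>y / (2 * t)\<bar> *\<^sub>R f (y\<^sup>2 / (4 * t))) has_integral Gamma x) {0<..}"
    by (simp add: has_integral_iff set_lebesgue_integral_eq_integral(1))
  then have "has_bochner_integral lborel (\<lambda>y. indicator {0<..} y *\<^sub>R (\<bar>y / (2 * t)\<bar> *\<^sub>R f (y\<^sup>2 / (4 * t)))) (Gamma x)"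
    by (intro has_bochner_integral_of_has_integral_nonneg) (auto simp: f_def)
  then have "has_bochner_integral lborel
      (\<lambda>y. (4 * t) powr (x - 1) * (2 * t) / sqrt (pi * t) * (indicator {0<..} y *\<^sub>R (\<bar>y / (2 * t)\<bar> *\<^sub>R f (y\<^sup>2 / (4 * t)))))
      ((4 * t) powr (x - 1) * (2 * t) / sqrt (pi * t) * Gamma x)"
    by (rule has_bochner_integral_mult_right)
  moreover have "(4 * t) powr (x - 1) * (2 * t) / sqrt (pi * t) *
      (indicator {0<..} y *\<^sub>R (\<bar>y / (2 * t)\<bar> *\<^sub>R f (y\<^sup>2 / (4 * t)))) =
      indicator {0<..} y *\<^sub>R (y powr a * (exp (- (y\<^sup>2 / (4 * t))) / sqrt (pi * t)))" for y
  proof (cases "y > 0")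
    case True
    have "(y\<^sup>2) powr (x - 1) = y powr (2 * (x - 1))"
      using True powr_powr[of y 2 "x - 1"] by simp
    moreover have "y powr (2 * (x - 1)) * y = y powr a"
    proof -
      have "2 * (x - 1) = a - 1" by (simp add: x_def field_simps)
      then show ?thesis using True powr_add[of y "a - 1" 1] by simp
    qed
    ultimately show ?thesis using True t
      by (simp add: f_def powr_divide exp_minus field_simps)
  qed simp
  moreover have "(4 * t) powr (x - 1) * (2 * t) / sqrt (pi * t) * Gamma x =
      t powr (a / 2) * Gamma (a + 1) * rGamma (a / 2 + 1)"
  proof -
    have "Gamma (a / 2 + 1) > 0"
      using a by (intro Gamma_real_pos) linarith
    moreover have "Gamma x * Gamma (a / 2 + 1) = 2 powr (- a) * sqrt pi * Gamma (a + 1)"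
      using Gamma_duplication_real[OF x] by (simp add: x_def add_divide_distrib add.commute)
    ultimately have "Gamma x = 2 powr (- a) * sqrt pi * Gamma (a + 1) * rGamma (a / 2 + 1)"
      by (simp add: rGamma_inverse_Gamma divide_inverse[symmetric] eq_divide_eq)
    moreover have "(4 * t) powr (x - 1) * (2 * t) / sqrt (pi * t) * (2 powr (- a) * sqrt pi) = t powr (a / 2)"
    proof -
      have "(4 * t) powr (x - 1) = (2 powr 2) powr (x - 1) * t powr (x - 1)"
        using t by (simp add: powr_mult)
      also have "(2 powr 2) powr (x - 1) = (2::real) powr (a - 1)"
        by (simp add: powr_powr x_def del: powr_numeral)
      also have "\<dots> * t powr (x - 1) = 2 powr a / 2 * (t powr (a / 2) / sqrt t)"
      proof -
        have "t powr (x - 1) = t powr (a / 2) / sqrt t"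
          using t powr_diff[of t "a / 2" "1 / 2"] by (simp add: powr_half_sqrt x_def field_simps)
        then show ?thesis by (simp add: powr_diff)
      qed
      finally have E: "(4 * t) powr (x - 1) = 2 powr a / 2 * (t powr (a / 2) / sqrt t)" .
      have "2 * t / sqrt (pi * t) = 2 * sqrt t / sqrt pi"
        using t real_div_sqrt[of t] by (simp add: real_sqrt_mult field_simps)
      then have "(4 * t) powr (x - 1) * (2 * t) / sqrt (pi * t) * (2 powr (- a) * sqrt pi) =
          2 powr a / 2 * (t powr (a / 2) / sqrt t) * (2 * sqrt t / sqrt pi) * (2 powr (- a) * sqrt pi)"
        unfolding E by (simp only: times_divide_eq_right[symmetric])
      also have "\<dots> = t powr (a / 2)"
        using t by (simp add: powr_minus)
      finally show ?thesis .
    qed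
    ultimately have "t powr (a / 2) * Gamma (a + 1) * rGamma (a / 2 + 1) =
        (4 * t) powr (x - 1) * (2 * t) / sqrt (pi * t) * (2 powr (- a) * sqrt pi) * (Gamma (a + 1) * rGamma (a / 2 + 1))"
      and "Gamma x = (2 powr (- a) * sqrt pi) * (Gamma (a + 1) * rGamma (a / 2 + 1))"
      by (simp_all only: mult.assoc)
    then show ?thesis by (simp only: mult.assoc)
  qed
  ultimately show ?thesis by simp
qed

subsection \<open>The crossing probability of a Gamma variable\<close>

lemma summable_exp_gamma_terms:
  fixes \<kappa> x :: real
  assumes "\<kappa> > 0" "x \<ge> 0"
  shows "summable (\<lambda>j. x ^ j / fact j / (\<kappa> + real j))"
proof (rule summable_comparison_test')
  have "summable (\<lambda>j. x ^ j / fact j)"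
    using summable_exp[of x] by (simp add: field_simps)
  then show "summable (\<lambda>j. x ^ j / fact j / \<kappa>)"
    by (rule summable_divide)
  fix j
  have "x ^ j / fact j / (\<kappa> + real j) \<le> x ^ j / fact j / \<kappa>"
    using assms by (intro divide_left_mono) auto
  moreover have "x ^ j / fact j / (\<kappa> + real j) \<ge> 0"
    using assms by auto
  ultimately show "norm (x ^ j / fact j / (\<kappa> + real j)) \<le> x ^ j / fact j / \<kappa>"
    by (simp only: real_norm_def abs_of_nonneg)
qed

text \<open>Each factor (\<kappa> + j)/(1 + j) is at most \<open>max 1 \<kappa>\<close>. The true
  growth is polynomial, but a geometric bound suffices against 1/\<Gamma>.\<close>

lemma abs_pochhammer_bound:
  fixes \<kappa> :: real
  assumes \<kappa>: "\<kappa> > 0"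
  shows "\<bar>pochhammer \<kappa> j / fact j\<bar> \<le> max 1 \<kappa> ^ j"
proof (induction j)
  case (Suc j)
  have "\<kappa> + real j \<le> max 1 \<kappa> * (1 + real j)"
    using \<kappa> mult_right_mono[of 1 "max 1 \<kappa>" "real j"] by (simp add: distrib_left)
  then have "\<bar>(\<kappa> + real j) / (1 + real j)\<bar> \<le> max 1 \<kappa>"
    using \<kappa> by (simp add: field_simps)
  with Suc.IH have "\<bar>pochhammer \<kappa> j / fact j\<bar> * \<bar>(\<kappa> + real j) / (1 + real j)\<bar> \<le> max 1 \<kappa> ^ j * max 1 \<kappa>"
    by (intro mult_mono) auto
  then show ?case
    by (simp add: pochhammer_Suc abs_mult mult_ac flip: power_Suc2)
qed simp

text \<open>Coefficients of y^(\<kappa> + j) in the regularised lower incomplete Gamma function at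
  \<open>rate * y\<close>.\<close>

definition gamma_cdf_coeff :: "real \<Rightarrow> real \<Rightarrow> nat \<Rightarrow> real" where
  "gamma_cdf_coeff rate \<kappa> j = rate powr \<kappa> / Gamma \<kappa> * ((- rate) ^ j / fact j / (\<kappa> + real j))"

context
  fixes rate \<kappa> :: real
  assumes rate: "rate > 0" and \<kappa>: "\<kappa> > 0"
begin

lemma abs_gamma_cdf_coeff:
  "\<bar>gamma_cdf_coeff rate \<kappa> j\<bar> = rate powr \<kappa> / Gamma \<kappa> * (rate ^ j / fact j / (\<kappa> + real j))"
  using rate \<kappa> Gamma_real_pos[OF \<kappa>] by (simp add: gamma_cdf_coeff_def abs_mult power_abs)

lemma summable_gamma_cdf_terms:
  assumes "y \<ge> 0"
  shows "summable (\<lambda>j. \<bar>gamma_cdf_coeff rate \<kappa> j\<bar> * y powr (\<kappa> + real j))"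
proof (cases "y = 0")
  case False
  have "summable (\<lambda>j. (rate powr \<kappa> / Gamma \<kappa> * y powr \<kappa>) * ((rate * y) ^ j / fact j / (\<kappa> + real j)))"
    using rate \<kappa> assms by (intro summable_mult summable_exp_gamma_terms) auto
  moreover have "\<bar>gamma_cdf_coeff rate \<kappa> j\<bar> * y powr (\<kappa> + real j) =
      (rate powr \<kappa> / Gamma \<kappa> * y powr \<kappa>) * ((rate * y) ^ j / fact j / (\<kappa> + real j))" for j
    unfolding abs_gamma_cdf_coeff
    using False assms by (simp add: powr_add powr_realpow power_mult_distrib)
  ultimately show ?thesis by simp
qed simp

lemma has_bochner_integral_gamma_density:
  assumes y: "y > 0"
  shows "has_bochner_integral lborel (\<lambda>z. indicator {..y} z *\<^sub>R gamma_density rate \<kappa> z)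
    (\<Sum>j. gamma_cdf_coeff rate \<kappa> j * y powr (\<kappa> + real j))"
proof -
  \<comment> \<open>Again \<open>b\<close> stands for a signed or an unsigned power of
    \<open>rate\<close>. The closed interval is harmless at z = 0, where \<open>powr\<close> gives 0
    just as the density does.\<close>
  define f where "f b j z = (b / fact j * (rate powr \<kappa> / Gamma \<kappa>)) *
      (indicator {0..y} z *\<^sub>R z powr (\<kappa> + real j - 1))" for b and j :: nat and z :: real
  have f: "has_bochner_integral lborel (f b j)
      ((b / fact j * (rate powr \<kappa> / Gamma \<kappa>)) * (y powr (\<kappa> + real j) / (\<kappa> + real j)))" for b j
  proof -
    have "((\<lambda>z. z powr (\<kappa> + real j - 1)) has_integral y powr (\<kappa> + real j) / (\<kappa> + real j)) {0..y}"
      using has_integral_powr_from_0[of "\<kappa> + real j - 1" y] y \<kappa> by simp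
    then show ?thesis
      unfolding f_def[abs_def]
      by (intro has_bochner_integral_mult_right has_bochner_integral_of_has_integral_nonneg) auto
  qed
  have abs_f: "\<bar>f ((- rate) ^ j) j z\<bar> = f (rate ^ j) j z" for j z
    using rate Gamma_real_pos[OF \<kappa>] by (simp add: f_def abs_mult power_abs)
  have "has_bochner_integral lborel (\<lambda>z. \<Sum>j. f ((- rate) ^ j) j z)
      (\<Sum>j. gamma_cdf_coeff rate \<kappa> j * y powr (\<kappa> + real j))"
  proof (rule has_bochner_integral_suminf)
    show "has_bochner_integral lborel (f ((- rate) ^ j) j)
        (gamma_cdf_coeff rate \<kappa> j * y powr (\<kappa> + real j))" for j
      using f[of "(- rate) ^ j" j] by (simp add: gamma_cdf_coeff_def mult_ac)
    show "has_bochner_integral lborel (\<lambda>z. \<bar>f ((- rate) ^ j) j z\<bar>)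
        (\<bar>gamma_cdf_coeff rate \<kappa> j\<bar> * y powr (\<kappa> + real j))" for j
      using f[of "rate ^ j" j] unfolding abs_f abs_gamma_cdf_coeff by (simp add: mult_ac)
    show "summable (\<lambda>j. \<bar>gamma_cdf_coeff rate \<kappa> j\<bar> * y powr (\<kappa> + real j))"
      using y by (intro summable_gamma_cdf_terms) simp
    show "summable (\<lambda>j. \<bar>f ((- rate) ^ j) j z\<bar>)" for z
    proof (cases "0 < z \<and> z \<le> y")
      case True
      have "summable (\<lambda>j. inverse (fact j) * (rate * z) ^ j * (rate powr \<kappa> / Gamma \<kappa> * z powr (\<kappa> - 1)))"
        by (intro summable_mult2 summable_exp)
      moreover have "\<bar>f ((- rate) ^ j) j z\<bar> = inverse (fact j) * (rate * z) ^ j * (rate powr \<kappa> / Gamma \<kappa> * z powr (\<kappa> - 1))" for j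
        unfolding abs_f using True powr_add[of z "\<kappa> - 1" "real j"]
        by (simp add: f_def powr_realpow power_mult_distrib field_simps)
      ultimately show ?thesis by simp
    next
      case False
      then show ?thesis by (cases "z = 0") (auto simp: f_def)
    qed
  qed
  moreover have "(\<Sum>j. f ((- rate) ^ j) j z) = indicator {..y} z *\<^sub>R gamma_density rate \<kappa> z" for z
  proof (cases "0 < z \<and> z \<le> y")
    case True
    have "(\<lambda>j. (- rate * z) ^ j /\<^sub>R fact j * (rate powr \<kappa> / Gamma \<kappa> * z powr (\<kappa> - 1))) sums
        (exp (- rate * z) * (rate powr \<kappa> / Gamma \<kappa> * z powr (\<kappa> - 1)))"
      by (intro sums_mult2 exp_converges)
    moreover have "f ((- rate) ^ j) j z = (- rate * z) ^ j /\<^sub>R fact j * (rate powr \<kappa> / Gamma \<kappa> * z powr (\<kappa> - 1))" for j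
    proof -
      have "z powr (\<kappa> + real j - 1) = z powr (\<kappa> - 1) * z ^ j"
        using True powr_add[of z "\<kappa> - 1" "real j"] by (simp add: powr_realpow diff_add_eq)
      then show ?thesis
        unfolding f_def power_mult_distrib using True by (simp add: divide_inverse)
    qed
    ultimately show ?thesis using True
      by (simp add: gamma_density_def sums_iff)
  next
    case False
    then show ?thesis by (cases "z = 0") (auto simp: f_def gamma_density_def)
  qed
  ultimately show ?thesis by simp
qed

lemma cdf_gamma:
  assumes "distributed M lborel G (\<lambda>z. ennreal (gamma_density rate \<kappa> z))" and y: "y > 0"
  shows "cdf (distr M borel G) y = (\<Sum>j. gamma_cdf_coeff rate \<kappa> j * y powr (\<kappa> + real j))"
proof -
  have nonneg: "gamma_density rate \<kappa> z \<ge> 0" for z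
    using rate Gamma_real_pos[OF \<kappa>] by (simp add: gamma_density_def)
  have [measurable]: "gamma_density rate \<kappa> \<in> borel_measurable borel"
    unfolding gamma_density_def[abs_def] by measurable
  note I = has_bochner_integral_gamma_density[OF y]
  have "distr M borel G = distr M lborel G"
    by (rule distr_cong) auto
  also have "\<dots> = density lborel (\<lambda>z. ennreal (gamma_density rate \<kappa> z))"
    using assms(1) by (rule distributed_distr_eq_density)
  finally have "emeasure (distr M borel G) {..y} = (\<integral>\<^sup>+z. ennreal (indicator {..y} z *\<^sub>R gamma_density rate \<kappa> z) \<partial>lborel)"
    by (simp add: emeasure_density mult.commute ennreal_mult' nonneg ennreal_indicator)
  also have "\<dots> = ennreal (\<Sum>j. gamma_cdf_coeff rate \<kappa> j * y powr (\<kappa> + real j))"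
    using I nonneg by (subst nn_integral_eq_integral) (auto simp: has_bochner_integral_iff)
  finally show ?thesis
    using I integral_nonneg_AE[where M = lborel and f = "\<lambda>z. indicator {..y} z *\<^sub>R gamma_density rate \<kappa> z"] nonneg
    by (simp add: cdf_def measure_def has_bochner_integral_iff)
qed

text \<open>Origin of the Pochhammer symbol in the Mittag-Leffler function: the moment contributes
  \<Gamma>(\<kappa> + j + 1), whose factor \<kappa> + j cancels the denominator, and
  \<Gamma>(\<kappa> + j)/\<Gamma>(\<kappa>) remains.\<close>

lemma gamma_cdf_coeff_times_Gamma:
  "gamma_cdf_coeff rate \<kappa> j * Gamma (\<kappa> + real j + 1) = rate powr \<kappa> * ((- rate) ^ j * (pochhammer \<kappa> j / fact j))"
proof -
  have pos: "\<kappa> + real j > 0" using \<kappa> by simp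
  have "pochhammer \<kappa> j = Gamma (\<kappa> + real j) / Gamma \<kappa>"
    using \<kappa> by (intro pochhammer_Gamma) (auto elim!: nonpos_Ints_cases)
  moreover have "Gamma (\<kappa> + real j + 1) = (\<kappa> + real j) * Gamma (\<kappa> + real j)"
    using pos by (intro Gamma_plus1) (auto elim!: nonpos_Ints_cases)
  moreover have "Gamma \<kappa> > 0" "Gamma (\<kappa> + real j) > 0"
    using \<kappa> pos by (auto intro: Gamma_real_pos)
  ultimately show ?thesis using pos
    by (simp add: gamma_cdf_coeff_def)
qed

text \<open>Even the unsigned series, which grows at most exponentially in y up to a power, is
  integrable against the Gaussian; in coefficients this is the decay of 1/\<Gamma>((\<kappa> + j)/2
  + 1). Integrability is recorded separately because the integral alone would not reveal it.\<close>

lemma crossing_psi_series: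
  assumes G: "distributed M lborel G (\<lambda>z. ennreal (gamma_density rate \<kappa> z))" and t: "t > 0"
  shows "crossing_psi M G t = 1 - (\<Sum>j. rate powr \<kappa> * ((- rate) ^ j * (pochhammer \<kappa> j / fact j)) *
      (t powr ((\<kappa> + real j) / 2) * rGamma ((\<kappa> + real j) / 2 + 1)))"
    and "set_integrable lborel {0<..} (\<lambda>y. (1 - cdf (distr M borel G) y) * (exp (- (y\<^sup>2 / (4 * t))) / sqrt (pi * t)))"
proof -
  define g where "g y = exp (- (y\<^sup>2 / (4 * t))) / sqrt (pi * t)" for y
  have g_nonneg: "g y \<ge> 0" for y using t by (simp add: g_def)
  let ?A = "gamma_cdf_coeff rate \<kappa>"
  define f where "f b j y = b * (indicator {0<..} y *\<^sub>R (y powr (\<kappa> + real j) * g y))" for b and j :: nat and y :: real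
  define I where "I b j = b * (t powr ((\<kappa> + real j) / 2) * Gamma (\<kappa> + real j + 1) * rGamma ((\<kappa> + real j) / 2 + 1))"
    for b and j :: nat
  have f: "has_bochner_integral lborel (f b j) (I b j)" for b j
    unfolding f_def[abs_def] I_def g_def using \<kappa> t
    by (intro has_bochner_integral_mult_right has_bochner_integral_gaussian_powr) auto
  have abs_f: "\<bar>f b j y\<bar> = f \<bar>b\<bar> j y" for b j y
    using g_nonneg by (simp add: f_def abs_mult)
  have "has_bochner_integral lborel (\<lambda>y. \<Sum>j. f (?A j) j y) (\<Sum>j. I (?A j) j)"
  proof (rule has_bochner_integral_suminf)
    show "has_bochner_integral lborel (f (?A j) j) (I (?A j) j)" for j by (rule f)
    show "has_bochner_integral lborel (\<lambda>y. \<bar>f (?A j) j y\<bar>) (I \<bar>?A j\<bar> j)" for j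
      unfolding abs_f by (rule f)
    show "summable (\<lambda>j. I \<bar>?A j\<bar> j)"
    proof (rule summable_comparison_test')
      show "summable (\<lambda>j. rate powr \<kappa> * t powr (\<kappa> / 2) *
          (\<bar>rGamma (real j / 2 + (\<kappa> / 2 + 1))\<bar> * (rate * max 1 \<kappa> * sqrt t) ^ j))"
        using rate t by (intro summable_mult summable_abs_rGamma_power_half) auto
      fix j
      have "\<bar>?A j * Gamma (\<kappa> + real j + 1)\<bar> = rate powr \<kappa> * (rate ^ j * \<bar>pochhammer \<kappa> j / fact j\<bar>)"
        using rate unfolding gamma_cdf_coeff_times_Gamma by (simp add: abs_mult power_abs)
      also have "\<dots> \<le> rate powr \<kappa> * (rate ^ j * max 1 \<kappa> ^ j)"
        using rate abs_pochhammer_bound[OF \<kappa>] by (intro mult_left_mono) auto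
      finally have A: "\<bar>?A j * Gamma (\<kappa> + real j + 1)\<bar> \<le> rate powr \<kappa> * (rate ^ j * max 1 \<kappa> ^ j)" .
      have "norm (I \<bar>?A j\<bar> j) = \<bar>?A j * Gamma (\<kappa> + real j + 1)\<bar> * (t powr ((\<kappa> + real j) / 2) * \<bar>rGamma ((\<kappa> + real j) / 2 + 1)\<bar>)"
        by (simp add: I_def abs_mult)
      also have "\<dots> \<le> rate powr \<kappa> * (rate ^ j * max 1 \<kappa> ^ j) * (t powr ((\<kappa> + real j) / 2) * \<bar>rGamma ((\<kappa> + real j) / 2 + 1)\<bar>)"
        by (intro mult_right_mono A) auto
      also have "t powr ((\<kappa> + real j) / 2) = t powr (\<kappa> / 2) * sqrt t ^ j"
        using powr_half_diff[OF t, of j "- \<kappa> / 2"] by (simp add: add_divide_distrib add.commute)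
      also have "(\<kappa> + real j) / 2 + 1 = real j / 2 + (\<kappa> / 2 + 1)"
        by (simp add: add_divide_distrib)
      finally show "norm (I \<bar>?A j\<bar> j) \<le> rate powr \<kappa> * t powr (\<kappa> / 2) *
          (\<bar>rGamma (real j / 2 + (\<kappa> / 2 + 1))\<bar> * (rate * max 1 \<kappa> * sqrt t) ^ j)"
        by (simp only: power_mult_distrib mult_ac)
    qed
    show "summable (\<lambda>j. \<bar>f (?A j) j y\<bar>)" for y
    proof (cases "y > 0")
      case True
      have "summable (\<lambda>j. \<bar>?A j\<bar> * y powr (\<kappa> + real j) * g y)"
        using True by (intro summable_mult2 summable_gamma_cdf_terms) simp
      then show ?thesis unfolding abs_f using True by (simp add: f_def mult_ac)
    qed (simp add: f_def)
  qed
  \<comment> \<open>The kernel has mass 1 on the half-line: the moment formula at a = 0.\<close>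
  moreover have "has_bochner_integral lborel (\<lambda>y. indicator {0<..} y *\<^sub>R g y) 1"
  proof -
    have "has_bochner_integral lborel (\<lambda>y. indicator {0<..} y *\<^sub>R (y powr 0 * g y)) 1"
      using has_bochner_integral_gaussian_powr[of 0 t] t by (simp add: g_def rGamma_inverse_Gamma)
    then show ?thesis
      by (rule has_bochner_integral_cong[THEN iffD1, rotated -1]) (auto simp: indicator_def)
  qed
  ultimately have "has_bochner_integral lborel
      (\<lambda>y. indicator {0<..} y *\<^sub>R g y - (\<Sum>j. f (?A j) j y)) (1 - (\<Sum>j. I (?A j) j))"
    by (intro has_bochner_integral_diff)
  moreover have "indicator {0<..} y *\<^sub>R g y - (\<Sum>j. f (?A j) j y) =
      indicator {0<..} y *\<^sub>R ((1 - cdf (distr M borel G) y) * g y)" for y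
  proof (cases "y > 0")
    case True
    have "(\<Sum>j. ?A j * y powr (\<kappa> + real j) * g y) = cdf (distr M borel G) y * g y"
      unfolding cdf_gamma[OF G True]
    proof (rule suminf_mult2[symmetric])
      show "summable (\<lambda>j. ?A j * y powr (\<kappa> + real j))"
        by (rule summable_rabs_cancel)
          (use summable_gamma_cdf_terms[of y] True in \<open>simp add: abs_mult\<close>)
    qed
    then show ?thesis using True by (simp add: f_def left_diff_distrib right_diff_distrib mult_ac)
  qed (simp add: f_def)
  ultimately have psi: "has_bochner_integral lborel
      (\<lambda>y. indicator {0<..} y *\<^sub>R ((1 - cdf (distr M borel G) y) * g y)) (1 - (\<Sum>j. I (?A j) j))"
    by simp
  show "set_integrable lborel {0<..} (\<lambda>y. (1 - cdf (distr M borel G) y) * (exp (- (y\<^sup>2 / (4 * t))) / sqrt (pi * t)))"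
    using psi by (simp add: set_integrable_def has_bochner_integral_iff g_def)
  have "I (?A j) j = rate powr \<kappa> * ((- rate) ^ j * (pochhammer \<kappa> j / fact j)) *
      (t powr ((\<kappa> + real j) / 2) * rGamma ((\<kappa> + real j) / 2 + 1))" for j
    unfolding gamma_cdf_coeff_times_Gamma[symmetric] I_def by (simp only: mult_ac)
  then show "crossing_psi M G t = 1 - (\<Sum>j. rate powr \<kappa> * ((- rate) ^ j * (pochhammer \<kappa> j / fact j)) *
      (t powr ((\<kappa> + real j) / 2) * rGamma ((\<kappa> + real j) / 2 + 1)))"
    using psi by (simp add: crossing_psi_def set_lebesgue_integral_def g_def has_bochner_integral_iff)
qed

lemma crossing_psi_mittag_leffler:
  assumes G: "distributed M lborel G (\<lambda>z. ennreal (gamma_density rate \<kappa> z))" and t: "t > 0"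
  shows "crossing_psi M G t =
    1 - (rate * sqrt t) powr \<kappa> * gen_mittag_leffler \<kappa> (1/2) (\<kappa>/2 + 1) (- rate * sqrt t)"
proof -
  let ?f = "\<lambda>j. pochhammer \<kappa> j * (- rate * sqrt t) ^ j / (fact j * Gamma (1/2 * real j + (\<kappa>/2 + 1)))"
  have "summable ?f"
  proof (rule summable_comparison_test')
    show "summable (\<lambda>j. \<bar>rGamma (real j / 2 + (\<kappa> / 2 + 1))\<bar> * (max 1 \<kappa> * (rate * sqrt t)) ^ j)"
      using rate t by (intro summable_abs_rGamma_power_half) auto
    fix j
    have "\<bar>pochhammer \<kappa> j / fact j\<bar> * (\<bar>rGamma (real j / 2 + (\<kappa> / 2 + 1))\<bar> * (rate * sqrt t) ^ j) \<le>
        max 1 \<kappa> ^ j * (\<bar>rGamma (real j / 2 + (\<kappa> / 2 + 1))\<bar> * (rate * sqrt t) ^ j)"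
      using rate t abs_pochhammer_bound[OF \<kappa>] by (intro mult_right_mono) auto
    moreover have "norm (?f j) =
        \<bar>pochhammer \<kappa> j / fact j\<bar> * (\<bar>rGamma (real j / 2 + (\<kappa> / 2 + 1))\<bar> * (rate * sqrt t) ^ j)"
      using rate t by (simp add: abs_mult power_abs rGamma_inverse_Gamma inverse_eq_divide)
    ultimately show "norm (?f j) \<le> \<bar>rGamma (real j / 2 + (\<kappa> / 2 + 1))\<bar> * (max 1 \<kappa> * (rate * sqrt t)) ^ j"
      by (simp only: power_mult_distrib mult_ac)
  qed
  then have "(rate * sqrt t) powr \<kappa> * gen_mittag_leffler \<kappa> (1/2) (\<kappa>/2 + 1) (- rate * sqrt t) =
      (\<Sum>j. (rate * sqrt t) powr \<kappa> * ?f j)"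
    unfolding gen_mittag_leffler_def by (rule suminf_mult[symmetric])
  also have "\<dots> = (\<Sum>j. rate powr \<kappa> * ((- rate) ^ j * (pochhammer \<kappa> j / fact j)) *
      (t powr ((\<kappa> + real j) / 2) * rGamma ((\<kappa> + real j) / 2 + 1)))"
  proof (rule suminf_cong)
    fix j
    have "t powr ((\<kappa> + real j) / 2) = t powr (\<kappa> / 2) * sqrt t ^ j"
      using powr_half_diff[OF t, of j "- \<kappa> / 2"] by (simp add: add_divide_distrib add.commute)
    moreover have "(\<kappa> + real j) / 2 + 1 = 1/2 * real j + (\<kappa> / 2 + 1)"
      by (simp add: add_divide_distrib)
    moreover have "(rate * sqrt t) powr \<kappa> = rate powr \<kappa> * t powr (\<kappa> / 2)"
      using rate t by (simp add: powr_mult powr_powr flip: powr_half_sqrt)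
    moreover have "?f j = pochhammer \<kappa> j / fact j * (- rate * sqrt t) ^ j * rGamma (1/2 * real j + (\<kappa> / 2 + 1))"
      by (simp add: rGamma_inverse_Gamma inverse_eq_divide)
    moreover have "(- rate * sqrt t) ^ j = (- rate) ^ j * sqrt t ^ j"
      by (rule power_mult_distrib)
    ultimately show "(rate * sqrt t) powr \<kappa> * ?f j = rate powr \<kappa> * ((- rate) ^ j * (pochhammer \<kappa> j / fact j)) *
        (t powr ((\<kappa> + real j) / 2) * rGamma ((\<kappa> + real j) / 2 + 1))"
      by (simp only: mult_ac)
  qed
  finally show ?thesis
    using crossing_psi_series(1)[OF G t] by simp
qed

end

section \<open>From the integral to the crossing probability\<close>

lemma measure_abs_less_eq_integral:
  fixes G X :: "'a \<Rightarrow> real"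
  assumes "prob_space M" and ind: "prob_space.indep_var M borel G borel X"
    and X: "distributed M lborel X (\<lambda>x. ennreal (h x))"
    and h: "\<And>x. h (- x) = h x" "\<And>x. h x \<ge> 0" "h \<in> borel_measurable borel"
    and int: "set_integrable lborel {0<..} (\<lambda>y. (1 - cdf (distr M borel G) y) * h y)"
  shows "measure M {\<omega> \<in> space M. \<bar>X \<omega>\<bar> < G \<omega>} =
    2 * (LINT y:{0<..}|lborel. (1 - cdf (distr M borel G) y) * h y)"
proof -
  interpret prob_space M by fact
  note [measurable] = h(3)
  have [measurable]: "G \<in> borel_measurable M" "X \<in> borel_measurable M"
    using ind by (auto dest: indep_var_rv1 indep_var_rv2)
  interpret DG: prob_space "distr M borel G" by (rule prob_space_distr) simp
  interpret DX: prob_space "distr M borel X" by (rule prob_space_distr) simp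
  interpret pair_sigma_finite "distr M borel G" "distr M borel X" ..
  let ?S = "{p :: real \<times> real. \<bar>snd p\<bar> < fst p}"
  let ?F = "\<lambda>y. (1 - cdf (distr M borel G) \<bar>y\<bar>) * h y"
  have [measurable]: "?S \<in> sets (borel \<Otimes>\<^sub>M borel)"
  proof -
    have "{p \<in> space (borel \<Otimes>\<^sub>M borel). \<bar>snd p\<bar> < (fst p :: real)} \<in> sets (borel \<Otimes>\<^sub>M borel)"
      by measurable
    then show ?thesis by (simp add: space_pair_measure)
  qed
  have [measurable]: "cdf (distr M borel G) \<in> borel_measurable borel"
    by (rule borel_measurable_mono) (auto simp: mono_def cdf_def intro!: DG.finite_measure_mono)
  \<comment> \<open>The strict inequality in the event matches the right-continuous distribution
    function exactly, atoms of \<open>G\<close> included.\<close>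
  have tail: "emeasure (distr M borel G) {y<..} = ennreal (1 - cdf (distr M borel G) y)" for y
  proof -
    have "{y<..} = space (distr M borel G) - {..y}" by auto
    then have "measure (distr M borel G) {y<..} = 1 - cdf (distr M borel G) y"
      using DG.prob_compl[of "{..y}"] by (simp add: cdf_def)
    then show ?thesis by (simp add: DG.emeasure_eq_measure)
  qed
  have "emeasure M {\<omega> \<in> space M. \<bar>X \<omega>\<bar> < G \<omega>} =
      emeasure (distr M (borel \<Otimes>\<^sub>M borel) (\<lambda>\<omega>. (G \<omega>, X \<omega>))) ?S"
    by (subst emeasure_distr) (auto intro!: arg_cong[where f = "emeasure M"])
  also have "distr M (borel \<Otimes>\<^sub>M borel) (\<lambda>\<omega>. (G \<omega>, X \<omega>)) = distr M borel G \<Otimes>\<^sub>M distr M borel X"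
    using ind by (simp add: indep_var_distribution_eq)
  \<comment> \<open>Independence gives a product law, sliced here at a fixed value y of
    \<open>X\<close>; each slice is a tail of \<open>G\<close> at \<bar>y\<bar>, so the integrand
    over y is even.\<close>
  also have "emeasure \<dots> ?S = (\<integral>\<^sup>+y. emeasure (distr M borel G) ((\<lambda>x. (x, y)) -` ?S) \<partial>distr M borel X)"
    by (rule emeasure_pair_measure_alt2) measurable
  also have "\<dots> = (\<integral>\<^sup>+y. ennreal (1 - cdf (distr M borel G) \<bar>y\<bar>) \<partial>distr M borel X)"
  proof -
    have "(\<lambda>x. (x, y)) -` ?S = {\<bar>y\<bar><..}" for y by auto
    then show ?thesis by (simp add: tail)
  qed
  also have "distr M borel X = density lborel (\<lambda>x. ennreal (h x))"
  proof -
    have "distr M borel X = distr M lborel X" by (rule distr_cong) auto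
    then show ?thesis using distributed_distr_eq_density[OF X] by simp
  qed
  also have "(\<integral>\<^sup>+y. ennreal (1 - cdf (distr M borel G) \<bar>y\<bar>) \<partial>density lborel (\<lambda>x. ennreal (h x))) =
      (\<integral>\<^sup>+y. ennreal (?F y) \<partial>lborel)"
    by (subst nn_integral_density) (auto simp: ennreal_mult' h mult.commute)
  also have "\<dots> = ennreal (2 * (LINT y:{0<..}|lborel. (1 - cdf (distr M borel G) y) * h y))"
  proof -
    have "has_bochner_integral lborel (\<lambda>y. indicator {0<..} y *\<^sub>R ((1 - cdf (distr M borel G) y) * h y))
        (LINT y:{0<..}|lborel. (1 - cdf (distr M borel G) y) * h y)"
      using int by (simp add: has_bochner_integral_iff set_integrable_def set_lebesgue_integral_def)
    then have "has_bochner_integral lborel (\<lambda>y. indicator {0..} y *\<^sub>R ?F y)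
        (LINT y:{0<..}|lborel. (1 - cdf (distr M borel G) y) * h y)"
      by (rule has_bochner_integral_cong_AE[THEN iffD1, rotated -1])
        (auto intro!: AE_I[where N = "{0}"] simp: indicator_def)
    then have "has_bochner_integral lborel ?F (2 *\<^sub>R (LINT y:{0<..}|lborel. (1 - cdf (distr M borel G) y) * h y))"
      by (rule has_bochner_integral_even_function) (simp add: h)
    moreover have "?F y \<ge> 0" for y
      using DG.prob_le_1 h(2) by (simp add: cdf_def)
    ultimately show ?thesis
      by (subst nn_integral_eq_integral) (auto simp: has_bochner_integral_iff)
  qed
  finally show ?thesis
    unfolding measure_def
    by (simp add: set_lebesgue_integral_def integral_nonneg_AE h(2) cdf_def DG.prob_le_1)
qed

lemma crossing_psi_eq_measure:
  assumes "prob_space M" and BM: "brownian_motion M 2 B" and ind: "indep_of_process M G B"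
    and G: "G \<in> borel_measurable M"
    and int: "set_integrable lborel {0<..}
        (\<lambda>y. (1 - cdf (distr M borel G) y) * (exp (- (y\<^sup>2 / (4 * t))) / sqrt (pi * t)))"
    and t: "t > 0"
  shows "crossing_psi M G t = measure M {\<omega> \<in> space M. \<bar>B t \<omega>\<bar> < G \<omega>}"
proof -
  interpret prob_space M by fact
  have B: "B t \<in> borel_measurable M" "B 0 \<in> borel_measurable M" "AE \<omega> in M. B 0 \<omega> = 0"
    "distributed M lborel (\<lambda>\<omega>. B t \<omega> - B 0 \<omega>) (\<lambda>x. ennreal (normal_density 0 (sqrt (2 * (t - 0))) x))"
    using BM t unfolding brownian_motion_def by (blast intro: less_imp_le)+
  note [measurable] = B(1,2)
  \<comment> \<open>The Gaussian law is given for increments, and \<open>B 0\<close> vanishes only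
    almost surely; equality of laws is all that is used.\<close>
  have "distr M lborel (B t) = distr M lborel (\<lambda>\<omega>. B t \<omega> - B 0 \<omega>)"
    using B(3) by (intro distr_cong_AE) auto
  then have X: "distributed M lborel (B t) (\<lambda>x. ennreal (normal_density 0 (sqrt (2 * t)) x))"
    using B(4) by (simp add: distributed_def)
  \<comment> \<open>The kernel is the density of \<bar>B t\<bar>, twice the normal density; this
    absorbs the factor 2 from the symmetry argument.\<close>
  have h: "normal_density 0 (sqrt (2 * t)) y = (exp (- (y\<^sup>2 / (4 * t))) / sqrt (pi * t)) / 2" for y
  proof -
    have "sqrt (2 * pi * (2 * t)) = 2 * sqrt (pi * t)"
      using real_sqrt_mult[of 4 "pi * t"] by (simp add: mult_ac)
    moreover have "(sqrt (2 * t))\<^sup>2 = 2 * t" using t by simp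
    ultimately show ?thesis unfolding normal_density_def by simp
  qed
  have "indep_var borel G borel (B t)"
    unfolding indep_var_eq
  proof (intro conjI)
    have sub: "sigma_sets (space M) {B t -` A \<inter> space M | A. A \<in> sets borel} \<subseteq>
        sigma_sets (space M) {B t -` A \<inter> space M | t A. 0 \<le> t \<and> A \<in> sets borel}"
      using less_imp_le[OF t] by (intro sigma_sets_subseteq) blast
    show "indep_set (sigma_sets (space M) {G -` A \<inter> space M | A. A \<in> sets borel})
        (sigma_sets (space M) {B t -` A \<inter> space M | A. A \<in> sets borel})"
      using ind unfolding indep_of_process_def indep_set_def
    proof (rule indep_sets_mono_sets)
      fix b
      show "case_bool (sigma_sets (space M) {G -` A \<inter> space M | A. A \<in> sets borel})
          (sigma_sets (space M) {B t -` A \<inter> space M | A. A \<in> sets borel}) b \<subseteq>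
        case_bool (sigma_sets (space M) {G -` A \<inter> space M | A. A \<in> sets borel})
          (sigma_sets (space M) {B t -` A \<inter> space M | t A. 0 \<le> t \<and> A \<in> sets borel}) b"
        using sub by (cases b) simp_all
    qed
  qed (use G in auto)
  from measure_abs_less_eq_integral[OF assms(1) this X] int
  have "measure M {\<omega> \<in> space M. \<bar>B t \<omega>\<bar> < G \<omega>} =
      2 * (LINT y:{0<..}|lborel. (1 - cdf (distr M borel G) y) * normal_density 0 (sqrt (2 * t)) y)"
    unfolding h using t by simp
  then show ?thesis
    unfolding h crossing_psi_def by simp
qed

subsection \<open>The fractional relaxation equation\<close>

text \<open>Pascal's rule in \<open>n\<close> writes the sum as a difference of two sums of lower
  order at offsets \<open>p\<close> and \<open>Suc p\<close>; Pascal's rule in \<open>m\<close> then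
  lowers the degree. The offset is there for this induction.\<close>

lemma alternating_binomial_sum_eq_0:
  assumes "m < n"
  shows "(\<Sum>j\<le>n. (-1) ^ j * real (n choose j) * real ((p + j) choose m)) = 0"
  using assms
proof (induction n arbitrary: p m)
  case (Suc n)
  let ?S = "\<lambda>p m. \<Sum>j\<le>n. (-1) ^ j * real (n choose j) * real ((p + j) choose m)"
  have "(\<Sum>j\<le>Suc n. (-1) ^ j * real (Suc n choose j) * real ((p + j) choose m)) = ?S p m - ?S (Suc p) m"
  proof -
    have "(\<Sum>j\<le>Suc n. (-1) ^ j * real (Suc n choose j) * real ((p + j) choose m)) =
        real (p choose m) + (\<Sum>j\<le>n. (-1) ^ Suc j * real (Suc n choose Suc j) * real ((p + Suc j) choose m))"
      by (subst sum.atMost_Suc_shift) simp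
    also have "(\<Sum>j\<le>n. (-1) ^ Suc j * real (Suc n choose Suc j) * real ((p + Suc j) choose m)) =
        (\<Sum>j\<le>n. (-1) ^ Suc j * real (n choose Suc j) * real ((p + Suc j) choose m)) - ?S (Suc p) m"
      unfolding sum_subtractf[symmetric] by (rule sum.cong) (auto simp: algebra_simps)
    also have "real (p choose m) + ((\<Sum>j\<le>n. (-1) ^ Suc j * real (n choose Suc j) * real ((p + Suc j) choose m)) - ?S (Suc p) m) =
        (\<Sum>j\<le>Suc n. (-1) ^ j * real (n choose j) * real ((p + j) choose m)) - ?S (Suc p) m"
      by (subst sum.atMost_Suc_shift) simp
    finally show ?thesis by simp
  qed
  also have "\<dots> = 0"
  proof (cases m)
    case (Suc l)
    have "?S (Suc p) m = ?S p m + ?S p l"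
      unfolding sum.distrib[symmetric] by (rule sum.cong) (auto simp: Suc algebra_simps)
    moreover have "?S p l = 0" using Suc.IH[of l p] Suc Suc.prems by simp
    ultimately show ?thesis by simp
  qed simp
  finally show ?case .
qed simp

text \<open>Keeping the lower index n - 1 fixed exhibits the coefficient as a polynomial in j of
  degree n - 1, one less than the order of the difference.\<close>

lemma pochhammer_over_fact_eq_choose:
  assumes n: "1 \<le> n"
  shows "pochhammer (real n) j / fact j = real ((n - 1 + j) choose (n - 1))"
proof -
  have "pochhammer (1::real) (n - 1 + j) = pochhammer 1 (n - 1) * pochhammer (1 + real (n - 1)) j"
    by (rule pochhammer_product')
  then have "fact (n - 1 + j) = fact (n - 1) * pochhammer (real n) j"
    using n by (simp flip: pochhammer_fact)
  then show ?thesis by (simp add: binomial_fact)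
qed

text \<open>
  The coefficients \<open>c\<close> of \<open>\<psi> - 1 = \<Sum>i. c i * t^(i/2) / \<Gamma>(i/2 + 1)\<close> for \<open>k = n\<close>, that is, the
  Mittag-Leffler series reindexed by \<open>i = n + j\<close>.
\<close>

definition crossing_coeff :: "real \<Rightarrow> nat \<Rightarrow> nat \<Rightarrow> real" where
  "crossing_coeff rate n i = (if i < n then 0
     else - ((-1) ^ (i - n) * rate ^ i * (pochhammer (real n) (i - n) / fact (i - n))))"

context
  fixes rate :: real and n :: nat
  assumes rate: "rate > 0" and n: "1 \<le> n"
begin

lemma abs_crossing_coeff_bound: "\<bar>crossing_coeff rate n i\<bar> \<le> (rate * real n) ^ i"
proof (cases "i < n")
  case False
  have "\<bar>pochhammer (real n) (i - n) / fact (i - n)\<bar> \<le> max 1 (real n) ^ (i - n)"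
    using n by (intro abs_pochhammer_bound) auto
  also have "\<dots> \<le> real n ^ i"
    using n by (simp add: max_def power_increasing)
  finally have "rate ^ i * \<bar>pochhammer (real n) (i - n) / fact (i - n)\<bar> \<le> rate ^ i * real n ^ i"
    using rate by (intro mult_left_mono) auto
  then show ?thesis using False rate
    by (simp add: crossing_coeff_def abs_mult power_mult_distrib)
qed (use rate in \<open>simp add: crossing_coeff_def\<close>)

lemma crossing_coeff_binomial_sum:
  "(\<Sum>j\<le>n. real (n choose j) * (1 / rate ^ j) * crossing_coeff rate n (p + j)) = (if p = 0 then -1 else 0)"
proof (cases "p = 0")
  case True
  have "(\<Sum>j\<le>n. real (n choose j) * (1 / rate ^ j) * crossing_coeff rate n j) =
      (\<Sum>j\<in>{n}. real (n choose j) * (1 / rate ^ j) * crossing_coeff rate n j)"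
    by (rule sum.mono_neutral_right) (auto simp: crossing_coeff_def)
  then show ?thesis using True rate by (simp add: crossing_coeff_def)
next
  case False
  \<comment> \<open>For p > 0 the cutoff below \<open>n\<close> agrees with the zeros of the
    binomial coefficient, so one polynomial formula covers all j. For p = 0 it would fail at j = 0,
    which is why that case stands apart and yields -1.\<close>
  have "real (n choose j) * (1 / rate ^ j) * crossing_coeff rate n (p + j) =
      - ((-1) ^ (p + n) * rate ^ p) * ((-1) ^ j * real (n choose j) * real (((p - 1) + j) choose (n - 1)))" for j
  proof (cases "p + j < n")
    case True
    then show ?thesis using False by (simp add: crossing_coeff_def binomial_eq_0)
  next
    case l: False
    have "n - 1 + (p + j - n) = p - 1 + j" using l False n by simp
    moreover have "(-1::real) ^ (p + j - n) = (-1) ^ (p + n) * (-1) ^ j"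
    proof -
      have "even (p + j - n) \<longleftrightarrow> even (p + n + j)" using l by auto
      then show ?thesis unfolding power_add[symmetric] by (simp add: minus_one_power_iff)
    qed
    ultimately show ?thesis using l rate
      by (simp add: crossing_coeff_def pochhammer_over_fact_eq_choose[OF n] power_add)
  qed
  then have "(\<Sum>j\<le>n. real (n choose j) * (1 / rate ^ j) * crossing_coeff rate n (p + j)) =
      - ((-1) ^ (p + n) * rate ^ p) * (\<Sum>j\<le>n. (-1) ^ j * real (n choose j) * real (((p - 1) + j) choose (n - 1)))"
    by (simp only: sum_distrib_left)
  also have "\<dots> = 0"
    using alternating_binomial_sum_eq_0[of "n - 1" n "p - 1"] n by simp
  finally show ?thesis using False by simp
qed

lemma half_series_relaxation:
  assumes t: "t > 0"
  shows "(\<Sum>j\<le>n. real (n choose j) * (1 / rate ^ j) * half_series (crossing_coeff rate n) (real j / 2) t) = -1"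
proof -
  let ?c = "crossing_coeff rate n"
  have C: "rate * real n \<ge> 0" "\<And>i. \<bar>?c i\<bar> \<le> (rate * real n) ^ i"
    using rate abs_crossing_coeff_bound by auto
  let ?w = "\<lambda>p. rGamma (real p / 2 + 1) * t powr (real p / 2)"
  \<comment> \<open>As j \<le> n, the discarded initial terms all have zero coefficient. Every
    derivative is thereby expanded in the common functions \<open>?w p\<close>, and coefficients can
    be summed over j.\<close>
  have shift: "(\<lambda>p. ?c (p + j) * ?w p) sums half_series ?c (real j / 2) t" if "j \<le> n" for j
  proof -
    let ?a = "\<lambda>i. ?c i * rGamma (real i / 2 + 1 - real j / 2) * t powr (real i / 2 - real j / 2)"
    have "?a sums half_series ?c (real j / 2) t"
      unfolding half_series_def by (intro summable_sums half_series_eq_power_series(2)[OF C t])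
    moreover have "(\<Sum>i<j. ?a i) = 0"
      using that by (intro sum.neutral) (auto simp: crossing_coeff_def)
    ultimately have "(\<lambda>p. ?a (p + j)) sums half_series ?c (real j / 2) t"
      using sums_split_initial_segment[of ?a _ j] by fastforce
    moreover have "?a (p + j) = ?c (p + j) * ?w p" for p
    proof -
      have "real (p + j) / 2 + 1 - real j / 2 = real p / 2 + 1" "real (p + j) / 2 - real j / 2 = real p / 2"
        by (simp_all add: field_simps)
      then show ?thesis by (simp only: mult.assoc)
    qed
    ultimately show ?thesis by (simp only:)
  qed
  have "(\<lambda>p. \<Sum>j\<le>n. real (n choose j) * (1 / rate ^ j) * (?c (p + j) * ?w p)) sums
      (\<Sum>j\<le>n. real (n choose j) * (1 / rate ^ j) * half_series ?c (real j / 2) t)"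
    by (intro sums_sum sums_mult shift) auto
  moreover have "(\<Sum>j\<le>n. real (n choose j) * (1 / rate ^ j) * (?c (p + j) * ?w p)) =
      (if p = 0 then -1 else 0)" for p
  proof -
    have "(\<Sum>j\<le>n. real (n choose j) * (1 / rate ^ j) * (?c (p + j) * ?w p)) =
        (\<Sum>j\<le>n. real (n choose j) * (1 / rate ^ j) * ?c (p + j)) * ?w p"
      by (simp add: sum_distrib_right mult.assoc)
    then show ?thesis
      unfolding crossing_coeff_binomial_sum using t by (simp add: rGamma_inverse_Gamma)
  qed
  ultimately have "(\<lambda>p. if p = 0 then -1 else 0) sums
      (\<Sum>j\<le>n. real (n choose j) * (1 / rate ^ j) * half_series ?c (real j / 2) t)"
    by simp
  then show ?thesis
    using sums_unique2 sums_single[of 0 "\<lambda>_. -1 :: real"] by blast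
qed

lemma crossing_psi_half_series:
  assumes G: "distributed M lborel G (\<lambda>z. ennreal (gamma_density rate (real n) z))" and t: "t > 0"
  shows "crossing_psi M G t = 1 + half_series (crossing_coeff rate n) 0 t"
proof -
  let ?c = "crossing_coeff rate n"
  have C: "rate * real n \<ge> 0" "\<And>i. \<bar>?c i\<bar> \<le> (rate * real n) ^ i"
    using rate abs_crossing_coeff_bound by auto
  let ?a = "\<lambda>i. ?c i * rGamma (real i / 2 + 1 - 0) * t powr (real i / 2 - 0)"
  let ?b = "\<lambda>j. rate powr real n * ((- rate) ^ j * (pochhammer (real n) j / fact j)) *
      (t powr ((real n + real j) / 2) * rGamma ((real n + real j) / 2 + 1))"
  have s: "summable ?a" by (rule half_series_eq_power_series(2)[OF C t])
  have "half_series ?c 0 t = (\<Sum>j. ?a (j + n))"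
    unfolding half_series_def
    by (subst suminf_split_initial_segment[OF s, of n]) (simp add: crossing_coeff_def)
  also have "(\<lambda>j. ?a (j + n)) = (\<lambda>j. - ?b j)"
  proof
    fix j
    have "rate ^ (j + n) = rate powr real n * rate ^ j"
      using rate by (simp add: power_add powr_realpow)
    moreover have "(- rate) ^ j = (-1) ^ j * rate ^ j" by (rule power_minus)
    ultimately show "?a (j + n) = - ?b j"
      by (simp add: crossing_coeff_def add_divide_distrib add.commute mult_ac)
  qed
  also have "(\<Sum>j. - ?b j) = - (\<Sum>j. ?b j)"
  proof (rule suminf_minus)
    have "summable (\<lambda>j. ?a (j + n))" using s by (rule summable_ignore_initial_segment)
    then have "summable (\<lambda>j. - ?b j)" using \<open>(\<lambda>j. ?a (j + n)) = (\<lambda>j. - ?b j)\<close> by simp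
    then show "summable ?b" by (simp add: summable_minus_iff)
  qed
  finally show ?thesis
    using crossing_psi_series(1)[OF rate _ G t] n by simp
qed

end

section \<open>Classical and Caputo derivatives of series in half-integral powers\<close>

lemma deriv_funpow_half_series:
  fixes u :: "real \<Rightarrow> real"
  assumes C: "C \<ge> 0" "\<And>i. \<bar>c i\<bar> \<le> C ^ i"
    and u: "\<And>t. t > 0 \<Longrightarrow> u t = d + half_series c 0 t" and t: "t > 0"
  shows "(deriv ^^ r) u t = (if r = 0 then d else 0) + half_series c (real r) t"
    and "(deriv ^^ r) u differentiable (at t)"
proof -
  \<comment> \<open>Knowledge of the r-th derivative on all t > 0 suffices, since a derivative
    depends only on a neighbourhood. Stated conditionally, this serves both as induction step and as
    source of differentiability.\<close>
  have D: "((deriv ^^ r) u has_real_derivative half_series c (real (Suc r)) t) (at t)"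
    if "\<And>t. t > 0 \<Longrightarrow> (deriv ^^ r) u t = (if r = 0 then d else 0) + half_series c (real r) t"
      and "t > 0" for r t
  proof -
    have "((\<lambda>t. (if r = 0 then d else 0) + half_series c (real r) t) has_real_derivative
        half_series c (real r + 1) t) (at t)"
      using DERIV_add[OF DERIV_const has_derivative_half_series[OF C that(2)]] by simp
    moreover have "\<forall>\<^sub>F s in nhds t. (if r = 0 then d else 0) + half_series c (real r) s = (deriv ^^ r) u s"
      using eventually_nhds_in_open[of "{0<..}" t] that by (auto elim!: eventually_mono)
    ultimately show ?thesis
      using DERIV_cong_ev[OF refl] by (fastforce simp: add.commute)
  qed
  have E: "t > 0 \<Longrightarrow> (deriv ^^ r) u t = (if r = 0 then d else 0) + half_series c (real r) t" for r t
  proof (induction r arbitrary: t)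
    case 0
    then show ?case using u by simp
  next
    case (Suc r)
    then show ?case using DERIV_imp_deriv[OF D[of r t]] by simp
  qed
  show "(deriv ^^ r) u t = (if r = 0 then d else 0) + half_series c (real r) t" using E t .
  show "(deriv ^^ r) u differentiable (at t)"
    using D[OF E t] by (auto simp: real_differentiable_def)
qed

text \<open>For odd j the kernel exponent 1 + j/2 - m is 1/2, so Abel's integral takes q = m back to
  m - 1/2 = j/2; its hypothesis m < n/2 + 1 follows from j \<le> n. The constant \<open>d\<close>
  drops out because m \<ge> 1.\<close>

lemma caputo_half_series:
  fixes u :: "real \<Rightarrow> real"
  assumes C: "C \<ge> 0" "\<And>i. \<bar>c i\<bar> \<le> C ^ i"
    and vanish: "\<And>i. i < n \<Longrightarrow> c i = 0"
    and u: "\<And>t. t > 0 \<Longrightarrow> u t = d + half_series c 0 t"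
    and t: "t > 0" and j: "1 \<le> j" "j \<le> n"
  shows "caputo_differentiable (real j / 2) u t"
    and "caputo_deriv (real j / 2) u t = half_series c (real j / 2) t"
proof -
  define m where "m = (j + 1) div 2"
  have m: "nat \<lceil>real j / 2\<rceil> = m" "m \<ge> 1"
    using j by (auto simp: m_def nat_eq_iff ceiling_eq_iff)
  have du: "(deriv ^^ r) u s = (if r = 0 then d else 0) + half_series c (real r) s"
      "(deriv ^^ r) u differentiable (at s)" if "s > 0" for r s
    by ((rule deriv_funpow_half_series[OF C u that]; assumption)+)
  have diff: "\<forall>i<m. \<forall>s\<in>{0<..t}. (deriv ^^ i) u differentiable (at s)"
    using du(2) by auto
  have "caputo_differentiable (real j / 2) u t \<and> caputo_deriv (real j / 2) u t = half_series c (real j / 2) t"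
  proof (cases "even j")
    case True
    then have "real j / 2 = real m" by (auto simp: m_def)
    then show ?thesis using diff m du(1)[OF t, of m]
      unfolding caputo_differentiable_def caputo_deriv_def by (simp add: Let_def)
  next
    case False
    then have jm: "real j / 2 = real m - 1/2" by (auto simp: m_def elim!: oddE)
    have "has_bochner_integral lborel
        (\<lambda>s. indicator {0<..<t} s *\<^sub>R (1 / (t - s) powr (1/2) * half_series c (real m) s))
        (Gamma (1/2) * half_series c (real m - 1/2) t)"
      using vanish jm j by (intro half_series_Abel_integral[OF C t, of n]) auto
    moreover have "indicator {0<..<t} s *\<^sub>R (1 / (t - s) powr (1/2) * half_series c (real m) s) =
        indicator {0<..<t} s *\<^sub>R caputo_integrand (real j / 2) u t s" for s
      using du(1)[of s m] m by (simp add: caputo_integrand_def jm indicator_def)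
    ultimately have I: "has_bochner_integral lborel
        (\<lambda>s. indicator {0<..<t} s *\<^sub>R caputo_integrand (real j / 2) u t s)
        (Gamma (1/2) * half_series c (real j / 2) t)"
      by (simp add: jm)
    have "real j / 2 \<noteq> real m" and "real m - real j / 2 = 1/2" using jm by linarith+
    from this(1) arg_cong[OF this(2), of Gamma]
    have "real j / 2 \<noteq> real m" "Gamma (real m - real j / 2) = Gamma (1/2)" .
    moreover have "Gamma (1/2 :: real) \<noteq> 0" by (simp add: Gamma_one_half_real)
    ultimately show ?thesis
      using I diff m(1) unfolding caputo_differentiable_def caputo_deriv_def
      by (simp add: Let_def set_integrable_def set_lebesgue_integral_def has_bochner_integral_iff)
  qed
  then show "caputo_differentiable (real j / 2) u t"
    and "caputo_deriv (real j / 2) u t = half_series c (real j / 2) t" by auto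
qed

theorem theorem2p4:
  fixes M :: "'a measure" and G :: "'a \<Rightarrow> real" and B :: "real \<Rightarrow> 'a \<Rightarrow> real"
    and rate k :: real
  assumes "rate > 0" and "k > 0"
    and "prob_space M"
    and "distributed M lborel G (\<lambda>z. ennreal (gamma_density rate k z))"
    and "brownian_motion M 2 B"
    and "indep_of_process M G B"
  shows "(\<forall>t>0. crossing_psi M G t = measure M {\<omega> \<in> space M. \<bar>B t \<omega>\<bar> < G \<omega>} \<and>
            measure M {\<omega> \<in> space M. \<bar>B t \<omega>\<bar> < G \<omega>} =
              1 - (rate * sqrt t) powr k * gen_mittag_leffler k (1/2) (k/2 + 1) (- rate * sqrt t)) \<and>
         (\<forall>n::nat. 1 \<le> n \<and> k = real n \<longrightarrow>
            (\<forall>t>0.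
               (\<forall>j\<in>{1..n}. caputo_differentiable (real j / 2) (crossing_psi M G) t) \<and>
               (\<Sum>j=1..n. real (n choose j) * (1 / rate ^ j) *
                   caputo_deriv (real j / 2) (crossing_psi M G) t) = - crossing_psi M G t) \<and>
            (crossing_psi M G \<longlongrightarrow> 1) (at_right 0) \<and>
            (odd n \<and> 1 < n \<longrightarrow>
               (\<forall>r\<in>{1..n div 2}. ((deriv ^^ r) (crossing_psi M G) \<longlongrightarrow> 0) (at_right 0))) \<and>
            (even n \<and> 2 < n \<longrightarrow>
               (\<forall>r\<in>{1..n div 2 - 1}. ((deriv ^^ r) (crossing_psi M G) \<longlongrightarrow> 0) (at_right 0))))"
proof (intro conjI allI impI)
  let ?psi = "crossing_psi M G"
  fix t :: real assume t: "t > 0"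
  have "G \<in> borel_measurable M"
    using distributed_measurable[OF assms(4)] by simp
  then show psi: "?psi t = measure M {\<omega> \<in> space M. \<bar>B t \<omega>\<bar> < G \<omega>}"
    using assms t by (intro crossing_psi_eq_measure crossing_psi_series(2))
  show "measure M {\<omega> \<in> space M. \<bar>B t \<omega>\<bar> < G \<omega>} =
      1 - (rate * sqrt t) powr k * gen_mittag_leffler k (1/2) (k/2 + 1) (- rate * sqrt t)"
    using crossing_psi_mittag_leffler[OF assms(1,2,4) t] psi by simp
next
  let ?psi = "crossing_psi M G"
  fix n :: nat
  assume "1 \<le> n \<and> k = real n"
  then have n: "1 \<le> n" and k: "k = real n" by auto
  let ?c = "crossing_coeff rate n"
  have C: "rate * real n \<ge> 0" "\<And>i. \<bar>?c i\<bar> \<le> (rate * real n) ^ i"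
    using assms(1) abs_crossing_coeff_bound[OF assms(1) n] by auto
  have vanish: "?c i = 0" if "i < n" for i
    using that by (simp add: crossing_coeff_def)
  have psi: "?psi t = 1 + half_series ?c 0 t" if "t > 0" for t
    using crossing_psi_half_series[OF assms(1) n assms(4)[unfolded k] that] .
  note cap = caputo_half_series[OF C vanish psi]
  {
    fix t :: real assume t: "t > 0"
    show "\<forall>j\<in>{1..n}. caputo_differentiable (real j / 2) ?psi t"
      using cap(1) t by auto
    have "(\<Sum>j=1..n. real (n choose j) * (1 / rate ^ j) * caputo_deriv (real j / 2) ?psi t) =
        (\<Sum>j=1..n. real (n choose j) * (1 / rate ^ j) * half_series ?c (real j / 2) t)"
      using cap(2) t by (intro sum.cong) auto
    \<comment> \<open>The j = 0 term, absent from the equation, is \<psi> - 1; moving it across the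
      total -1 leaves -\<psi>.\<close>
    moreover have "(\<Sum>j\<le>n. real (n choose j) * (1 / rate ^ j) * half_series ?c (real j / 2) t) =
        half_series ?c 0 t + (\<Sum>j=1..n. real (n choose j) * (1 / rate ^ j) * half_series ?c (real j / 2) t)"
      by (simp add: atMost_atLeast0 sum.atLeast_Suc_atMost)
    ultimately show "(\<Sum>j=1..n. real (n choose j) * (1 / rate ^ j) * caputo_deriv (real j / 2) ?psi t) = - ?psi t"
      using half_series_relaxation[OF assms(1) n t] psi[OF t] by simp
  }
  have "((\<lambda>t. 1 + half_series ?c 0 t) \<longlongrightarrow> 1 + 0) (at_right 0)"
    using n by (intro tendsto_add tendsto_const tendsto_half_series_0[OF C, of n]) (auto simp: vanish)
  then have "((\<lambda>t. 1 + half_series ?c 0 t) \<longlongrightarrow> 1) (at_right 0)"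
    by simp
  then show "(?psi \<longlongrightarrow> 1) (at_right 0)"
    by (rule Lim_transform_eventually) (auto simp: eventually_at_filter psi)
  \<comment> \<open>One condition for both parities: \<open>2 * r < n\<close> means r \<le> (n-1)/2
    for odd n and r \<le> n/2 - 1 for even n. It is sharp, as for even n the derivative of order n/2
    tends to -\<lambda>^n.\<close>
  have initial: "((deriv ^^ r) ?psi \<longlongrightarrow> 0) (at_right 0)" if "1 \<le> r" "2 * r < n" for r
  proof (rule Lim_transform_eventually)
    show "(half_series ?c (real r) \<longlongrightarrow> 0) (at_right 0)"
      using that by (intro tendsto_half_series_0[OF C, of n]) (auto simp: vanish)
    show "\<forall>\<^sub>F t in at_right 0. half_series ?c (real r) t = (deriv ^^ r) ?psi t"
      using deriv_funpow_half_series(1)[OF C psi, of _ r] that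
      by (auto simp: eventually_at_filter)
  qed
  show "\<forall>r\<in>{1..n div 2}. ((deriv ^^ r) ?psi \<longlongrightarrow> 0) (at_right 0)" if "odd n \<and> 1 < n"
    using that by (auto intro!: initial elim!: oddE)
  show "\<forall>r\<in>{1..n div 2 - 1}. ((deriv ^^ r) ?psi \<longlongrightarrow> 0) (at_right 0)" if "even n \<and> 2 < n"
    using that by (auto intro!: initial elim!: evenE)
qed

end
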